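(* Consider AdaCSFW with learning rates $\eta_t=\frac{m\lambda_t^-}{L\|A\|_2^2}$ and step-size bounds $\gamma_t=\frac{2}{t+2}$, and let $\kappa=\lambda_0^+/\lambda_0^-$. Then for all $t\in\{1,\ldots,T\}$, $$\mathsf{E}[f(x_t)]-\min_{\mathcal{C}}f\leq\frac{2L}{t+1}\left(4K(K+1)D_1^AD_\infty^A\left(\frac1b-\frac1m\right)+\frac{\kappa\|A\|_2^2D_2^2}{m}\right)+\frac{2(K+1)D_\infty^A(m/b)^2}{t(t+1)}\left(\|f'(x_0)-\alpha_0\|_1+\frac{16KLD_1^A}{b}\right).$$
   Context: Problem. $\mathcal{C}\subset\mathbb{R}^n$ is a compact convex set, $a_1,\ldots,a_m\in\mathbb{R}^n$ are data samples, $f_1,\ldots,f_m\colon\mathbb{R}\to\mathbb{R}$ are smooth convex functions, and $f(x)=\frac1m\sum_{i=1}^m f_i(\langle a_i,x\rangle)$. $L$ is the common smoothness constant of the scalar functions $f_i$ over the problem's domain: $|f_i'(r)-f_i'(s)|\leq L|r-s|$ for all $i$ and all $r,s\in\{\langle a_i,x\rangle\mid x\in\mathcal{C}\}$. $A\in\mathbb{R}^{m\times n}$ is the matrix with rows $a_1^\top,\ldots,a_m^\top$; $\|A\|_2=\max_{\|x\|_2=1}\|Ax\|_2$; $D_p^A=\max_{x,y\in\mathcal{C}}\|A(y-x)\|_p$; $D_2=\max_{x,y\in\mathcal{C}}\|y-x\|_2$. For $x\in\mathbb{R}^n$, $f'(x)\in\mathbb{R}^m$ denotes the vector with entries $[f'(x)]_i=\frac1m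 f_i'(\langle a_i,x\rangle)$. For a symmetric positive definite matrix $H$, $\|x\|_H=\sqrt{\langle x,Hx\rangle}$. AdaCSFW. Inputs: a start point $x_0\in\mathcal{C}$, batch-size $b\in\mathbb{N}\setminus\{0\}$, bounds $0<\lambda_t^-\leq\lambda_{t+1}^-\leq\lambda_{t+1}^+\leq\lambda_t^+$, a number of inner iterations $K\in\mathbb{N}\setminus\{0\}$, learning rates $\eta_t>0$, step-size bounds $\gamma_t\in[0,1]$. Initialize $\alpha_{-1}=0\in\mathbb{R}^m$ and $\tilde\nabla f(x_{-1})=0\in\mathbb{R}^n$. For $t=0,\ldots,T-1$: 1. Sample $i_1,\ldots,i_b$ i.i.d. uniformly from $\{1,\ldots,m\}$. For $i=1,\ldots,m$, set $[\alpha_t]_i=\frac1m f_i'(\langle a_i,x_t\rangle)$ if $i\in\{i_1,\ldots,i_b\}$ and $[\alpha_t]_i=[\alpha_{t-1}]_i$ otherwise. Set $\tilde\nabla f(x_t)=\tilde\nabla f(x_{t-1})+\sum_{j=1}^b([\alpha_t]_{i_j}-[\alpha_{t-1}]_{i_j})a_{i_j}$. 2. Update the diagonal matrix $H_t\in\mathbb{R}^{n\times n}$ (any diagonal matrix with positive diagonal entries is allowed) and clip its diagonal entries to $[\lambda_t^-,\lambda_t^+]$. 3. Let $Q_t(x)=f(x_t)+\langle\tilde\nabla f(x_t),x-x_t\rangle+\frac{1}{2\eta_t}\|x-x_t\|_{H_t}^2$, so $\nabla Q_t(y)=\tilde\nabla f(x_t)+\frac{1}{\eta_t}H_t(y-x_t)$.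 Set $y_0^{(t)}=x_t$ and, for $k=0,\ldots,K-1$: choose $v_k^{(t)}\in\arg\min_{v\in\mathcal{C}}\langle\nabla Q_t(y_k^{(t)}),v\rangle$; set $\gamma_k^{(t)}=\min\left\{\eta_t\frac{\langle\nabla Q_t(y_k^{(t)}),y_k^{(t)}-v_k^{(t)}\rangle}{\|y_k^{(t)}-v_k^{(t)}\|_{H_t}^2},\gamma_t\right\}$ (if $v_k^{(t)}=y_k^{(t)}$ the value is immaterial); set $y_{k+1}^{(t)}=y_k^{(t)}+\gamma_k^{(t)}(v_k^{(t)}-y_k^{(t)})$. 4. Set $x_{t+1}=y_K^{(t)}$. $\mathsf{E}$ is the expectation with respect to all the randomness in the algorithm.
   Formalization: The formal theorem takes b ≤ m and samples each mini-batch uniformly without replacement (i.i.d. sampling with b ≥ 2 makes the stated bound false; for b = 1 the schemes coincide); the random term ‖f'(x_0) − α_0‖_1 on the right side is replaced by its expectation. *)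

theory Defs
  imports "HOL-Probability.Probability"
begin

definition objective :: "('m::finite \<Rightarrow> real^'n) \<Rightarrow> ('m \<Rightarrow> real \<Rightarrow> real) \<Rightarrow> real^'n \<Rightarrow> real" where
  "objective a f x = (\<Sum>i\<in>UNIV. f i (a i \<bullet> x)) / real CARD('m)"

text \<open>The vector written \<open>f'(x)\<close> on paper; it is not the gradient of the objective, which is
  \<open>transpose A *v f'(x)\<close>.\<close>

definition deriv_vec :: "('m::finite \<Rightarrow> real^'n) \<Rightarrow> ('m \<Rightarrow> real \<Rightarrow> real) \<Rightarrow> real^'n \<Rightarrow> real^'m" where
  "deriv_vec a f x = (\<chi> i. deriv (f i) (a i \<bullet> x) / real CARD('m))"

definition data_matrix :: "('m::finite \<Rightarrow> real^'n) \<Rightarrow> real^'n^'m" where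
  "data_matrix a = (\<chi> i. a i)"

definition spectral_norm :: "real^'n^'m::finite \<Rightarrow> real" where
  "spectral_norm A = onorm ((*v) A)"

definition l1norm :: "real^'m::finite \<Rightarrow> real" where
  "l1norm u = (\<Sum>i\<in>UNIV. \<bar>u $ i\<bar>)"

text \<open>\<open>D\<^sub>p\<^sup>A\<close> for the norm \<open>N\<close>. On a nonempty compact set the supremum is a
  maximum; the same remark applies to \<open>diameter\<close> and to the infimum of the objective.\<close>

definition image_diameter :: "(real^'m \<Rightarrow> real) \<Rightarrow> real^'n^'m::finite \<Rightarrow> (real^'n) set \<Rightarrow> real" where
  "image_diameter N A C = (SUP (x, y)\<in>C \<times> C. N (A *v (y - x)))"

definition mat_norm :: "real^'n^'n \<Rightarrow> real^'n \<Rightarrow> real" where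
  "mat_norm H x = sqrt (x \<bullet> (H *v x))"

definition clip_diag :: "real \<Rightarrow> real \<Rightarrow> real^'n^'n \<Rightarrow> real^'n^'n" where
  "clip_diag lo hi H = (\<chi> i j. if i = j then max lo (min hi (H $ i $ i)) else 0)"

text \<open>The gradient at \<open>y\<close> of
  \<open>Q(y) = f(x) + \<langle>g, y - x\<rangle> + (1 / (2 * \<eta>)) * (mat_norm H (y - x))\<^sup>2\<close>.\<close>

definition model_grad :: "real^'n \<Rightarrow> real \<Rightarrow> real^'n^'n \<Rightarrow> real^'n \<Rightarrow> real^'n \<Rightarrow> real^'n" where
  "model_grad g \<eta> H x y = g + (1 / \<eta>) *\<^sub>R (H *v (y - x))"

text \<open>The possible outcomes of drawing a mini-batch \<open>i\<^sub>1, \<dots>, i\<^sub>b\<close> uniformly without replacement.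

  On paper the \<open>i\<^sub>j\<close> of one batch are called i.i.d. uniform. For \<open>b = 1\<close> the two schemes
  coincide. For \<open>b \<ge> 2\<close> the rate (with its factors \<open>b / m\<close> and \<open>1 / b - 1 / m\<close>) rests on every
  data index lying in the batch with probability \<open>b / m\<close>, and on the estimator being
  \<open>transpose A *v \<alpha>\<^sub>t\<close>; both fail if an index can be repeated, because the update then counts its
  increment several times and the error is never corrected. The rate is false in that
  case: take \<open>m = b = 2\<close>, \<open>a\<^sub>1 = a\<^sub>2 = 1\<close>, \<open>C = [-1, 1]\<close>, \<open>f\<^sub>1(r) = 5 * r\<close>, \<open>f\<^sub>2(r) = - 4 * r\<close>,
  \<open>L = K = 1\<close> and \<open>H\<^sub>t = 1\<close>. With probability at least \<open>1 / 6\<close> (batch \<open>(2, 2)\<close> first, and index \<open>1\<close>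
  first seen in a batch containing both indices) the estimator settles at \<open>- 3 / 2\<close> although the
  gradient is \<open>1 / 2\<close>, and \<open>x\<^sub>t\<close> tends to the maximiser.\<close>

definition batches :: "nat \<Rightarrow> 'm::finite list set" where
  "batches b = {is. length is = b \<and> distinct is}"

text \<open>A run of the algorithm for \<open>T\<close> iterations. Index types: \<open>'n\<close> for coordinates, \<open>'m\<close> for data
  samples. The sigma-algebra \<open>F t\<close> describes what is known before the batch of iteration \<open>t\<close> is
  drawn; the matrices \<open>G t\<close> (before clipping) and the minimisers \<open>v t k\<close> are chosen in an
  arbitrary, possibly randomised way, but without looking at later batches.

  For \<open>v t k \<omega> = y t k \<omega>\<close> the quotient in the step-size is \<open>0\<close> by the convention \<open>x / 0 = 0\<close>; the
  step-size is immaterial then.\<close>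

locale adacsfw = prob_space M + filtration "space M" F
  for M :: "'w measure" and F :: "nat \<Rightarrow> 'w measure" +
  fixes C :: "(real^'n) set"
    and a :: "'m::finite \<Rightarrow> real^'n"
    and f :: "'m \<Rightarrow> real \<Rightarrow> real"
    and T b K :: nat
    and lo hi \<eta> \<gamma> :: "nat \<Rightarrow> real"
    and x0 :: "real^'n"
    and batch :: "nat \<Rightarrow> 'w \<Rightarrow> 'm list"
    and \<alpha> :: "nat \<Rightarrow> 'w \<Rightarrow> real^'m"
    and g :: "nat \<Rightarrow> 'w \<Rightarrow> real^'n"
    and G H :: "nat \<Rightarrow> 'w \<Rightarrow> real^'n^'n"
    and v y :: "nat \<Rightarrow> nat \<Rightarrow> 'w \<Rightarrow> real^'n"
    and \<gamma>' :: "nat \<Rightarrow> nat \<Rightarrow> 'w \<Rightarrow> real"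
    and x :: "nat \<Rightarrow> 'w \<Rightarrow> real^'n"
  assumes start_point: "x0 \<in> C"
    and batch_size: "1 \<le> b" "b \<le> CARD('m)"
    and inner_iterations: "1 \<le> K"
    and clip_bounds:
      "\<And>t. t < T \<Longrightarrow> 0 < lo t \<and> lo t \<le> lo (Suc t) \<and> lo (Suc t) \<le> hi (Suc t) \<and> hi (Suc t) \<le> hi t"
    and learning_rate_pos: "\<And>t. t < T \<Longrightarrow> 0 < \<eta> t"
    and step_bound: "\<And>t. t < T \<Longrightarrow> 0 \<le> \<gamma> t \<and> \<gamma> t \<le> 1"
    and F_subalgebra: "\<And>t. subalgebra M (F t)"
    and batch_measurable: "\<And>t. t < T \<Longrightarrow> batch t \<in> F (Suc t) \<rightarrow>\<^sub>M count_space UNIV"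
    and batch_distr:
      "\<And>t. t < T \<Longrightarrow> distr M (count_space UNIV) (batch t) = measure_pmf (pmf_of_set (batches b))"
    and batch_indep:
      "\<And>t. t < T \<Longrightarrow> indep_set (sets (F t)) {batch t -` S \<inter> space M | S. True}"
    and G_measurable: "\<And>t. t < T \<Longrightarrow> G t \<in> borel_measurable (F (Suc t))"
    and v_measurable: "\<And>t k. t < T \<Longrightarrow> k < K \<Longrightarrow> v t k \<in> borel_measurable (F (Suc t))"
    and init: "\<And>\<omega>. \<omega> \<in> space M \<Longrightarrow> x 0 \<omega> = x0"
    and \<alpha>_update: "\<And>t \<omega> i. t < T \<Longrightarrow> \<omega> \<in> space M \<Longrightarrow>
      \<alpha> t \<omega> $ i =
        (if i \<in> set (batch t \<omega>) then deriv (f i) (a i \<bullet> x t \<omega>) / real CARD('m)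
         else (if t = 0 then 0 else \<alpha> (t - 1) \<omega>) $ i)"
    and g_update: "\<And>t \<omega>. t < T \<Longrightarrow> \<omega> \<in> space M \<Longrightarrow>
      g t \<omega> = (if t = 0 then 0 else g (t - 1) \<omega>) +
        (\<Sum>j<b. (\<alpha> t \<omega> $ (batch t \<omega> ! j) - (if t = 0 then 0 else \<alpha> (t - 1) \<omega>) $ (batch t \<omega> ! j))
                 *\<^sub>R a (batch t \<omega> ! j))"
    and G_diagonal: "\<And>t \<omega> i j. t < T \<Longrightarrow> \<omega> \<in> space M \<Longrightarrow> i \<noteq> j \<Longrightarrow> G t \<omega> $ i $ j = 0"
    and G_positive: "\<And>t \<omega> i. t < T \<Longrightarrow> \<omega> \<in> space M \<Longrightarrow> 0 < G t \<omega> $ i $ i"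
    and H_clip: "\<And>t \<omega>. t < T \<Longrightarrow> \<omega> \<in> space M \<Longrightarrow> H t \<omega> = clip_diag (lo t) (hi t) (G t \<omega>)"
    and inner_init: "\<And>t \<omega>. t < T \<Longrightarrow> \<omega> \<in> space M \<Longrightarrow> y t 0 \<omega> = x t \<omega>"
    and v_minimiser: "\<And>t k \<omega>. t < T \<Longrightarrow> k < K \<Longrightarrow> \<omega> \<in> space M \<Longrightarrow>
      is_arg_min (\<lambda>w. model_grad (g t \<omega>) (\<eta> t) (H t \<omega>) (x t \<omega>) (y t k \<omega>) \<bullet> w) (\<lambda>w. w \<in> C) (v t k \<omega>)"
    and step_size: "\<And>t k \<omega>. t < T \<Longrightarrow> k < K \<Longrightarrow> \<omega> \<in> space M \<Longrightarrow>
      \<gamma>' t k \<omega> =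
        min (\<eta> t * (model_grad (g t \<omega>) (\<eta> t) (H t \<omega>) (x t \<omega>) (y t k \<omega>) \<bullet> (y t k \<omega> - v t k \<omega>))
                 / (mat_norm (H t \<omega>) (y t k \<omega> - v t k \<omega>))\<^sup>2)
            (\<gamma> t)"
    and inner_step: "\<And>t k \<omega>. t < T \<Longrightarrow> k < K \<Longrightarrow> \<omega> \<in> space M \<Longrightarrow>
      y t (Suc k) \<omega> = y t k \<omega> + \<gamma>' t k \<omega> *\<^sub>R (v t k \<omega> - y t k \<omega>)"
    and outer_step: "\<And>t \<omega>. t < T \<Longrightarrow> \<omega> \<in> space M \<Longrightarrow> x (Suc t) \<omega> = y t K \<omega>"

end

theory Submission
  imports Defs
begin

text \<open>By the choice of the learning rate and smoothness, the objective at \<open>x (t + 1)\<close> is at most the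
  quadratic model there plus the estimation error paired with the displacement. A clipped exact line
  search does no worse than the step-size \<open>\<gamma> t\<close>, so the first inner iteration already gives a
  Frank-Wolfe descent step, and the remaining ones do not increase the model. Hence the expected gap
  contracts by \<open>1 - \<gamma> t\<close> up to a term of order \<open>(\<gamma> t)\<^sup>2\<close> and a multiple of \<open>\<gamma> t\<close> times the expected
  \<open>\<ell>\<^sub>1\<close> error of \<open>\<alpha> t\<close>. A fresh batch keeps each coordinate of that error with probability
  \<open>1 - b / m\<close>, independently of the past, and the iterates move by at most \<open>K * \<gamma> t\<close> diameters, so the
  errors obey a linear recurrence. Summing it twice bounds the sum of \<open>(s + 1)\<close> times the error
  at time \<open>s\<close>, which is what multiplying the gap recurrence by \<open>(t + 1) * (t + 2)\<close> requires.\<close>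

section \<open>Convexity and smoothness of the objective\<close>

lemma data_matrix_nth [simp]: "(data_matrix a *v z) $ i = a i \<bullet> z"
  by (simp add: data_matrix_def matrix_vector_mult_def inner_vec_def)

text \<open>Hoelder's inequality for the exponents 1 and \<infinity>. It pairs the estimation error,
  measured by \<open>l1norm\<close>, with displacements, measured by \<open>infnorm\<close>.\<close>

lemma inner_le_l1norm_infnorm: "u \<bullet> w \<le> l1norm u * infnorm w" for u w :: "real^'m"
proof -
  have "u $ i * w $ i \<le> \<bar>u $ i\<bar> * infnorm w" for i
  proof -
    have "u $ i * w $ i \<le> \<bar>u $ i\<bar> * \<bar>w $ i\<bar>"
      by (metis abs_ge_self abs_mult)
    also have "\<dots> \<le> \<bar>u $ i\<bar> * infnorm w"
      by (intro mult_left_mono component_le_infnorm_cart) simp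
    finally show ?thesis .
  qed
  then show ?thesis
    by (simp add: inner_vec_def l1norm_def sum_distrib_right sum_mono)
qed

lemma l1norm_nonneg: "0 \<le> l1norm u"
  by (simp add: l1norm_def sum_nonneg)

lemma l1norm_scaleR: "l1norm (c *\<^sub>R u) = \<bar>c\<bar> * l1norm u"
  by (simp add: l1norm_def abs_mult sum_distrib_left)

lemma l1norm_triangle: "l1norm (u + w) \<le> l1norm u + l1norm w"
  by (simp add: l1norm_def sum.distrib[symmetric] sum_mono abs_triangle_ineq)

text \<open>A supremum of reals bounds its members once the set is bounded above; here the set is a
  continuous image of the compact set \<open>C \<times> C\<close>.\<close>

lemma le_image_diameter:
  fixes C :: "(real^'n) set" and A :: "real^'n^'m"
  assumes "compact C" "continuous_on UNIV N" "x \<in> C" "y \<in> C"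
  shows "N (A *v (y - x)) \<le> image_diameter N A C"
proof -
  have "continuous_on (C \<times> C) (\<lambda>p. N (A *v (snd p - fst p)))"
    by (intro continuous_on_compose2[OF assms(2)]
        bounded_linear.continuous_on[OF matrix_vector_mul_bounded_linear] continuous_intros) auto
  then have "compact ((\<lambda>p. N (A *v (snd p - fst p))) ` (C \<times> C))"
    by (intro compact_continuous_image compact_Times assms)
  then have "bdd_above ((\<lambda>p. N (A *v (snd p - fst p))) ` (C \<times> C))"
    by (simp add: bounded_imp_bdd_above compact_imp_bounded)
  from cSUP_upper[OF _ this, of "(x, y)"] assms show ?thesis
    by (simp add: image_diameter_def case_prod_unfold)
qed

lemma convex_above_tangent_UNIV:
  fixes h :: "real \<Rightarrow> real"
  assumes "convex_on UNIV h" and "\<And>r. h differentiable (at r)"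
  shows "h r + deriv h r * (s - r) \<le> h s"
proof -
  have "(h has_field_derivative deriv h r) (at r)"
    using assms(2) by (simp add: DERIV_deriv_iff_real_differentiable)
  from convex_on_imp_above_tangent[OF assms(1) _ _ _ this, of s] show ?thesis
    by simp
qed

text \<open>Adding the tangent inequalities at \<open>r\<close> and at \<open>s\<close> cancels the
  function values. Monotonicity later yields Borel measurability of
  \<open>deriv (f i)\<close>.\<close>

lemma mono_deriv_convex:
  fixes h :: "real \<Rightarrow> real"
  assumes "convex_on UNIV h" and "\<And>r. h differentiable (at r)"
  shows "mono (deriv h)"
proof
  fix r s :: real assume "r \<le> s"
  have "(deriv h s - deriv h r) * (s - r) \<ge> 0"
    using convex_above_tangent_UNIV[OF assms, of r s] convex_above_tangent_UNIV[OF assms, of s r]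
    by (simp add: algebra_simps)
  with \<open>r \<le> s\<close> show "deriv h r \<le> deriv h s"
    by (cases "r = s") (auto simp: zero_le_mult_iff)
qed

text \<open>The descent lemma, localised to an interval \<open>I\<close> because the smoothness
  constant refers only to values attained on \<open>C\<close>.\<close>

lemma lipschitz_deriv_upper_bound:
  fixes h :: "real \<Rightarrow> real"
  assumes diff: "\<And>r. h differentiable (at r)"
    and lip: "\<And>r s. r \<in> I \<Longrightarrow> s \<in> I \<Longrightarrow> \<bar>deriv h r - deriv h s\<bar> \<le> L * \<bar>r - s\<bar>"
    and I: "convex I" "r \<in> I" "s \<in> I"
  shows "h s \<le> h r + deriv h r * (s - r) + L / 2 * (s - r)\<^sup>2"
proof -
  define d where "d = s - r"
  \<comment> \<open>\<open>\<phi>\<close> is \<open>h\<close> along the segment minus the linear and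
    quadratic terms of the bound, so \<open>\<phi> 1 \<le> \<phi> 0\<close> is the claim. Its
    derivative \<open>(deriv h (r + \<tau> * d) - deriv h r) * d - L * \<tau> * d\<^sup>2\<close> is
    nonpositive by the Lipschitz bound.\<close>
  define \<phi> where "\<phi> \<tau> = h (r + \<tau> * d) - \<tau> * (deriv h r * d) - \<tau>\<^sup>2 * (L / 2 * d\<^sup>2)" for \<tau>
  have "\<phi> 1 \<le> \<phi> 0"
  proof (rule DERIV_nonpos_imp_nonincreasing[of 0 1 \<phi>])
    fix \<tau> :: real assume \<tau>: "0 \<le> \<tau>" "\<tau> \<le> 1"
    have mem: "r + \<tau> * d \<in> I"
      using convexD[OF I, of "1 - \<tau>" \<tau>] \<tau> by (simp add: d_def algebra_simps)
    have [derivative_intros]: "(h has_real_derivative deriv h z) (at z)" for z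
      using diff by (simp add: DERIV_deriv_iff_real_differentiable)
    have "(\<phi> has_real_derivative
        deriv h (r + \<tau> * d) * d - deriv h r * d - 2 * \<tau> * (L / 2 * d\<^sup>2)) (at \<tau>)"
      unfolding \<phi>_def by (rule derivative_eq_intros DERIV_chain2[where f = h] refl | simp)+
    moreover have "(deriv h (r + \<tau> * d) - deriv h r) * d \<le> \<bar>deriv h (r + \<tau> * d) - deriv h r\<bar> * \<bar>d\<bar>"
      by (metis abs_ge_self abs_mult)
    moreover have "\<bar>deriv h (r + \<tau> * d) - deriv h r\<bar> * \<bar>d\<bar> \<le> (L * \<bar>\<tau> * d\<bar>) * \<bar>d\<bar>"
      using lip[OF mem I(2)] by (intro mult_right_mono) auto
    moreover have "(L * \<bar>\<tau> * d\<bar>) * \<bar>d\<bar> = L * \<tau> * d\<^sup>2"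
      using \<tau> by (simp add: abs_mult power2_eq_square)
    ultimately show "\<exists>w. (\<phi> has_real_derivative w) (at \<tau>) \<and> w \<le> 0"
      by (intro exI[where x = "deriv h (r + \<tau> * d) * d - deriv h r * d - 2 * \<tau> * (L / 2 * d\<^sup>2)"])
        (auto simp: algebra_simps)
  qed simp
  then show ?thesis
    by (simp add: \<phi>_def d_def algebra_simps)
qed

text \<open>Pairing \<open>deriv_vec\<close> with \<open>data_matrix a *v (w - z)\<close> applies
  the gradient at \<open>z\<close> to \<open>w - z\<close>, so this is the average of the scalar
  tangent inequalities.\<close>

lemma objective_above_tangent:
  fixes a :: "'m::finite \<Rightarrow> real^'n"
  assumes "\<And>i r. f i differentiable (at r)" and "\<And>i. convex_on UNIV (f i)"
  shows "objective a f z + deriv_vec a f z \<bullet> (data_matrix a *v (w - z)) \<le> objective a f w"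
proof -
  have "f i (a i \<bullet> z) + deriv (f i) (a i \<bullet> z) * (a i \<bullet> (w - z)) \<le> f i (a i \<bullet> w)" for i
    using convex_above_tangent_UNIV[OF assms(2,1)] by (simp add: inner_diff_right)
  then have "(\<Sum>i\<in>UNIV. f i (a i \<bullet> z) + deriv (f i) (a i \<bullet> z) * (a i \<bullet> (w - z)))
      \<le> (\<Sum>i\<in>UNIV. f i (a i \<bullet> w))"
    by (rule sum_mono)
  from divide_right_mono[OF this, of "real CARD('m)"] show ?thesis
    by (simp add: objective_def deriv_vec_def inner_vec_def sum.distrib add_divide_distrib
        sum_divide_distrib)
qed

lemma objective_upper_bound:
  fixes a :: "'m::finite \<Rightarrow> real^'n"
  assumes "\<And>i r. f i differentiable (at r)"
    and "\<And>i r s. r \<in> (\<lambda>z. a i \<bullet> z) ` C \<Longrightarrow> s \<in> (\<lambda>z. a i \<bullet> z) ` C \<Longrightarrow>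
      \<bar>deriv (f i) r - deriv (f i) s\<bar> \<le> L * \<bar>r - s\<bar>"
    and "convex C" "z \<in> C" "w \<in> C"
  shows "objective a f w \<le> objective a f z + deriv_vec a f z \<bullet> (data_matrix a *v (w - z))
    + L / (2 * real CARD('m)) * (norm (data_matrix a *v (w - z)))\<^sup>2"
proof -
  \<comment> \<open>A linear functional maps \<open>C\<close> to a convex set of reals, which serves
    as \<open>I\<close> in the scalar descent lemma.\<close>
  have "convex ((\<lambda>z. a i \<bullet> z) ` C)" for i
    using assms(3) by (intro convex_linear_image) (auto intro: bounded_linear.linear bounded_linear_inner_right)
  then have "f i (a i \<bullet> w) \<le> f i (a i \<bullet> z) + deriv (f i) (a i \<bullet> z) * (a i \<bullet> (w - z))
      + L / 2 * (a i \<bullet> (w - z))\<^sup>2" for i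
    using lipschitz_deriv_upper_bound[OF assms(1,2), where I = "(\<lambda>z. a i \<bullet> z) ` C" and r = "a i \<bullet> z" and s = "a i \<bullet> w"] assms(4,5)
    by (auto simp: inner_diff_right)
  then have "(\<Sum>i\<in>UNIV. f i (a i \<bullet> w)) \<le> (\<Sum>i\<in>UNIV. f i (a i \<bullet> z)
      + deriv (f i) (a i \<bullet> z) * (a i \<bullet> (w - z)) + L / 2 * (a i \<bullet> (w - z))\<^sup>2)"
    by (rule sum_mono)
  from divide_right_mono[OF this, of "real CARD('m)"] show ?thesis
    unfolding power2_norm_eq_inner
    by (simp add: objective_def deriv_vec_def inner_vec_def sum.distrib add_divide_distrib
        sum_divide_distrib sum_distrib_left power2_eq_square)
qed

section \<open>The quadratic model\<close>

lemma clip_diag_mult_nth: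
  "(clip_diag l h G *v u) $ i = max l (min h (G $ i $ i)) * u $ i"
  by (simp add: clip_diag_def matrix_vector_mult_def if_distrib[where f = "\<lambda>c. c * _"] cong: if_cong)

lemma clip_diag_symmetric: "u \<bullet> (clip_diag l h G *v w) = w \<bullet> (clip_diag l h G *v u)"
  by (simp add: inner_vec_def clip_diag_mult_nth mult_ac)

lemma clip_diag_bounds:
  fixes u :: "real^'n"
  assumes "l \<le> h"
  shows "l * (norm u)\<^sup>2 \<le> u \<bullet> (clip_diag l h G *v u)" (is ?lower)
    and "u \<bullet> (clip_diag l h G *v u) \<le> h * (norm u)\<^sup>2" (is ?upper)
proof -
  have "l * (u $ i)\<^sup>2 \<le> max l (min h (G $ i $ i)) * (u $ i)\<^sup>2"
    and "max l (min h (G $ i $ i)) * (u $ i)\<^sup>2 \<le> h * (u $ i)\<^sup>2" for i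
    using assms by (auto intro!: mult_right_mono)
  then show ?lower and ?upper
    unfolding power2_norm_eq_inner inner_vec_def clip_diag_mult_nth sum_distrib_left
    by (auto intro!: sum_mono simp: power2_eq_square mult_ac)
qed

lemma mat_norm_clip_diag:
  assumes "0 \<le> l" "l \<le> h"
  shows "(mat_norm (clip_diag l h G) u)\<^sup>2 = u \<bullet> (clip_diag l h G *v u)"
proof -
  have "0 \<le> l * (norm u)\<^sup>2"
    using assms by simp
  with clip_diag_bounds(1)[OF assms(2), of u G] show ?thesis
    by (simp add: mat_norm_def)
qed

text \<open>This is \<open>Q\<close> without its constant \<open>f(x)\<close>, so that its value at
  \<open>x\<close> is 0.\<close>

definition model :: "real^'n \<Rightarrow> real \<Rightarrow> real^'n^'n \<Rightarrow> real^'n \<Rightarrow> real^'n \<Rightarrow> real" where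
  "model g \<eta> H x y = g \<bullet> (y - x) + 1 / (2 * \<eta>) * ((y - x) \<bullet> (H *v (y - x)))"

text \<open>A quadratic agrees with its second-order expansion; symmetry of \<open>H\<close> merges
  the two mixed terms into the gradient term.\<close>

lemma model_along_line:
  assumes sym: "\<And>u w. u \<bullet> (H *v w) = w \<bullet> (H *v u)"
  shows "model g \<eta> H x (y + s *\<^sub>R d)
    = model g \<eta> H x y + s * (model_grad g \<eta> H x y \<bullet> d) + s\<^sup>2 * (d \<bullet> (H *v d)) / (2 * \<eta>)"
proof -
  define u where "u = y - x"
  have eq: "y + s *\<^sub>R d - x = u + s *\<^sub>R d"
    by (simp add: u_def)
  have lin: "H *v (u + s *\<^sub>R d) = H *v u + s *\<^sub>R (H *v d)"
    by (simp add: matrix_vector_right_distrib matrix_vector_mult_scaleR)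
  show ?thesis
    unfolding model_def model_grad_def eq lin unfolding u_def[symmetric]
    using sym[of u d]
    \<comment> \<open>For \<open>\<eta> = 0\<close> all quotients are 0 by convention, and only the
      linear part remains on both sides.\<close>
    by (cases "\<eta> = 0")
      (simp_all add: inner_add_left inner_add_right inner_commute field_simps power2_eq_square)
qed

text \<open>The map \<open>r \<mapsto> r\<^sup>2 * q / (2 * \<eta>) - r * p\<close> is a parabola
  with vertex \<open>\<eta> * p / q\<close> and decreases up to it, so the vertex clipped at
  \<open>c\<close> is its minimiser on \<open>[0, c]\<close>. If \<open>q = 0\<close>, then
  \<open>p = 0\<close> and all values are 0.\<close>

lemma clipped_line_search:
  fixes p q :: real
  assumes "0 \<le> p" "0 \<le> q" "q = 0 \<Longrightarrow> p = 0" "0 < \<eta>" "0 \<le> s" "s \<le> c"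
  defines "r \<equiv> min (\<eta> * p / q) c"
  shows "r\<^sup>2 * q / (2 * \<eta>) - r * p \<le> s\<^sup>2 * q / (2 * \<eta>) - s * p"
proof (cases "r = s \<or> q = 0")
  case True
  with assms show ?thesis by auto
next
  case False
  with assms have q: "0 < q" by auto
  \<comment> \<open>This product is \<open>2 * \<eta>\<close> times the difference of the two sides.
    It is a multiple of a square if \<open>r\<close> is the vertex, and a product of two nonpositive
    factors if \<open>r = c\<close> lies before the vertex.\<close>
  have "(s - r) * (q * (s + r) - 2 * \<eta> * p) \<ge> 0"
  proof (cases "\<eta> * p / q \<le> c")
    case True
    then have "q * r = \<eta> * p" using q by (simp add: r_def)
    then have "(s - r) * (q * (s + r) - 2 * \<eta> * p) = q * (s - r)\<^sup>2"
      by algebra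
    then show ?thesis using q by simp
  next
    case False
    then have "r = c" "q * c \<le> \<eta> * p" using q by (auto simp: r_def field_simps)
    moreover have "q * s \<le> q * c" using q assms by simp
    ultimately show ?thesis
      using assms by (intro mult_nonpos_nonpos) (auto simp: algebra_simps)
  qed
  then have "0 \<le> (s - r) * (q * (s + r) - 2 * \<eta> * p) / (2 * \<eta>)"
    using assms(4) by simp
  also have "\<dots> = (s\<^sup>2 * q / (2 * \<eta>) - s * p) - (r\<^sup>2 * q / (2 * \<eta>) - r * p)"
    using assms(4) by (simp add: field_simps power2_eq_square)
  finally show ?thesis
    by simp
qed

section \<open>The distribution of a mini-batch\<close>

lemma finite_batches: "finite (batches b :: 'm::finite list set)"
  using finite_lists_length_eq[of "UNIV :: 'm set" b]
  by (auto simp: batches_def elim: rev_finite_subset)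

lemma batches_eq: "batches b = {xs. length xs = b \<and> distinct xs \<and> set xs \<subseteq> UNIV}"
  by (simp add: batches_def)

lemma batches_nonempty:
  assumes "b \<le> CARD('m::finite)"
  shows "(batches b :: 'm list set) \<noteq> {}"
proof -
  obtain xs :: "'m list" where "set xs = UNIV" "distinct xs"
    using finite_distinct_list[of "UNIV :: 'm set"] by auto
  with assms have "take b xs \<in> batches b"
    by (auto simp: batches_def min_def distinct_card[symmetric])
  then show ?thesis by blast
qed

text \<open>The batches avoiding \<open>i\<close> are the injective lists over the other
  \<open>m - 1\<close> indices; the quotient of the two falling factorials is
  \<open>(m - b) / m\<close>.\<close>

lemma prob_not_in_batch:
  fixes i :: "'m::finite"
  assumes "b \<le> CARD('m)"
  shows "measure (measure_pmf (pmf_of_set (batches b))) {xs. i \<notin> set xs} = 1 - real b / real CARD('m)"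
proof -
  have set_eq: "batches b \<inter> {xs. i \<notin> set xs} = {xs. length xs = b \<and> distinct xs \<and> set xs \<subseteq> UNIV - {i}}"
    by (auto simp: batches_def)
  have m: "CARD('m) \<ge> 1"
    by (simp add: Suc_leI)
  have "real (card (batches b \<inter> {xs. i \<notin> set xs})) * real CARD('m)
      = real (card (batches b :: 'm list set)) * (real CARD('m) - real b)"
  \<comment> \<open>A batch of full size contains every index. Otherwise \<open>b\<close> is at most
    the number \<open>p\<close> of remaining indices, as the formula for counting injective lists
    requires.\<close>
  proof (cases "b = CARD('m)")
    case True
    have "i \<in> set xs" if "length xs = b" "distinct xs" for xs
      using that True by (metis UNIV_I card_eq_UNIV_imp_eq_UNIV distinct_card finite)
    then have "batches b \<inter> {xs. i \<notin> set xs} = {}"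
      by (auto simp: batches_def)
    with True show ?thesis by simp
  next
    case False
    define p where "p = CARD('m) - 1"
    have p: "CARD('m) = Suc p" using m by (simp add: p_def)
    with False assms have "b \<le> p" by simp
    then have c1: "card (batches b \<inter> {xs. i \<notin> set xs}) = \<Prod>{p - b + 1..p}"
      unfolding set_eq by (subst card_lists_distinct_length_eq) (auto simp: p_def card_Diff_singleton)
    have c2: "card (batches b :: 'm list set) = \<Prod>{Suc p - b + 1..Suc p}"
      unfolding batches_eq using assms by (subst card_lists_distinct_length_eq) (auto simp: p)
    \<comment> \<open>The two falling factorials share all factors except the lowest,
      \<open>p - b + 1\<close>, and the highest, \<open>Suc p\<close>.\<close>
    have "(p - b + 1) * \<Prod>{Suc p - b + 1..Suc p} = \<Prod>{p - b + 1..Suc p}"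
      using \<open>b \<le> p\<close> by (subst (2) prod.atLeast_Suc_atMost) (auto simp: Suc_diff_le)
    also have "\<dots> = \<Prod>{p - b + 1..p} * Suc p"
      using \<open>b \<le> p\<close> by (subst prod.nat_ivl_Suc') auto
    finally have "real (p - b + 1) * real (card (batches b :: 'm list set))
        = real (card (batches b \<inter> {xs. i \<notin> set xs})) * real (Suc p)"
      unfolding c1 c2 by (metis of_nat_mult)
    moreover have "real (p - b + 1) = real CARD('m) - real b"
      using \<open>b \<le> p\<close> p by simp
    ultimately show ?thesis
      using p by (metis mult.commute)
  qed
  moreover have "card (batches b :: 'm list set) > 0"
    using finite_batches batches_nonempty[OF assms] by (simp add: card_gt_0_iff)
  moreover have "1 - real b / real CARD('m) = (real CARD('m) - real b) / real CARD('m)"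
    by (simp add: diff_divide_distrib)
  ultimately show ?thesis
    by (simp add: measure_pmf_of_set[OF batches_nonempty[OF assms] finite_batches] frac_eq_eq
        mult.commute)
qed

section \<open>Recurrences for real sequences\<close>

text \<open>The recurrence contracts by \<open>1 - 1 / u\<close>, so a unit of input contributes at
  most a geometric series to the sum. It is used with \<open>u = m / b\<close>.\<close>

lemma contracting_sum_bound:
  fixes w d :: "nat \<Rightarrow> real"
  assumes "1 \<le> u" and "\<And>s. 0 \<le> w s"
    and "\<And>s. Suc s < Suc n \<Longrightarrow> u * w (Suc s) \<le> (u - 1) * (w s + d s)"
  shows "(\<Sum>s<Suc n. w s) \<le> u * w 0 + (u - 1) * (\<Sum>s<n. d s)"
proof -
  \<comment> \<open>The extra \<open>(u - 1) * w k\<close> stands for what is still to come: the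
    left-hand side grows by \<open>u * w (Suc k) - (u - 1) * w k\<close>, which is at most
    \<open>(u - 1) * d k\<close>. It is nonnegative and dropped at the end.\<close>
  have "(\<Sum>s<Suc k. w s) + (u - 1) * w k \<le> u * w 0 + (u - 1) * (\<Sum>s<k. d s)" if "k \<le> n" for k
    using that
  proof (induction k)
    case (Suc k)
    with assms(3)[of k] show ?case
      by (simp add: algebra_simps)
  qed (simp add: algebra_simps)
  from this[of n] assms(1,2) show ?thesis
    by (smt (verit) mult_nonneg_nonneg order_refl)
qed

text \<open>Each term is at most \<open>ln (n + 2) - ln (n + 1)\<close>, and these differences
  telescope.\<close>

lemma sum_inverse_le_ln: "(\<Sum>s<n. 1 / (real s + 2)) \<le> ln (real n + 1)"
proof (induction n)
  case (Suc n)
  have "ln ((real n + 1) / (real n + 2)) \<le> (real n + 1) / (real n + 2) - 1"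
    by (intro ln_le_minus_one) simp
  also have "\<dots> = - (1 / (real n + 2))"
    by (simp add: field_simps)
  finally show ?case
    using Suc by (simp add: ln_div algebra_simps)
qed simp

text \<open>\<open>contracting_sum_bound\<close> is applied first to \<open>e\<close> and then to
  \<open>(s + 1) * e s\<close>, whose input contains \<open>e\<close> itself. The harmonic sum
  \<open>h\<close> from the first application is absorbed into terms linear in \<open>t\<close> and
  constant in \<open>t\<close>, so that no logarithm survives.\<close>

lemma error_sum_bound:
  fixes e :: "nat \<Rightarrow> real"
  assumes u: "1 \<le> u" and c: "0 \<le> c" and e: "\<And>s. 0 \<le> e s" and t: "1 \<le> t"
    and rec: "\<And>s. Suc s < t \<Longrightarrow> u * e (Suc s) \<le> (u - 1) * (e s + c * (2 / (real s + 2)))"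
  shows "(\<Sum>s<t. (real s + 1) * e s) \<le> 4 * real t * c * (u - 1) + u\<^sup>2 * (e 0 + 16 * c * u)"
proof -
  obtain n where n: "t = Suc n"
    using t by (cases t) auto
  define h where "h = (\<Sum>s<n. 1 / (real s + 2))"
  have "h \<le> ln (real t)"
    using sum_inverse_le_ln[of n] by (simp add: h_def n add.commute)
  \<comment> \<open>Splitting at \<open>u\<close> before using \<open>ln z \<le> z - 1\<close> gives
    the coefficient \<open>1 / u\<close> of \<open>t\<close>, which cancels the factor
    \<open>u\<close> multiplying \<open>h\<close>.\<close>
  also have "\<dots> = ln (real t / u) + ln u"
    using u t by (simp add: ln_div)
  also have "\<dots> \<le> real t / u + u"
    using u t ln_le_minus_one[of "real t / u"] ln_le_minus_one[of u] by simp
  finally have "u * h \<le> real t + u\<^sup>2"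
    using u by (simp add: field_simps power2_eq_square)
  moreover have h: "0 \<le> h"
    unfolding h_def by (intro sum_nonneg) simp
  ultimately have "(u - 1) * h \<le> real t + u\<^sup>2"
    using u by (simp add: algebra_simps)
  then have "(u - 1) * ((u - 1) * h) \<le> (u - 1) * (real t + u\<^sup>2)"
    using u by (intro mult_left_mono) auto
  also have "\<dots> \<le> (u - 1) * real t + u ^ 3"
    by (simp add: algebra_simps power2_eq_square power3_eq_cube)
  finally have h_bound: "(u - 1) * ((u - 1) * h) \<le> (u - 1) * real t + u ^ 3" .
  have sum_e: "(\<Sum>s<t. e s) \<le> u * e 0 + (u - 1) * (2 * c * h)"
  proof -
    have "(\<Sum>s<Suc n. e s) \<le> u * e 0 + (u - 1) * (\<Sum>s<n. c * (2 / (real s + 2)))"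
      using rec by (intro contracting_sum_bound u e) (auto simp: n)
    then show ?thesis
      by (simp add: n h_def sum_distrib_left mult.commute)
  qed
  \<comment> \<open>Multiplying the recurrence by \<open>s + 2\<close> turns the drift
    \<open>2 * c / (s + 2)\<close> into the constant \<open>2 * c\<close>; writing
    \<open>(s + 2) * e s\<close> as \<open>(s + 1) * e s + e s\<close> makes
    \<open>e s + 2 * c\<close> the input for the weighted sequence.\<close>
  have "(\<Sum>s<Suc n. (real s + 1) * e s)
      \<le> u * ((real 0 + 1) * e 0) + (u - 1) * (\<Sum>s<n. e s + 2 * c)"
  proof (rule contracting_sum_bound)
    fix s assume "Suc s < Suc n"
    with rec have "u * e (Suc s) \<le> (u - 1) * (e s + c * (2 / (real s + 2)))"
      by (simp add: n)
    then have "(real s + 2) * (u * e (Suc s)) \<le> (real s + 2) * ((u - 1) * (e s + c * (2 / (real s + 2))))"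
      by (intro mult_left_mono) auto
    also have "\<dots> = (u - 1) * ((real s + 1) * e s + (e s + 2 * c))"
      by (simp add: field_simps)
    finally show "u * ((real (Suc s) + 1) * e (Suc s)) \<le> (u - 1) * ((real s + 1) * e s + (e s + 2 * c))"
      by (simp add: algebra_simps)
  qed (use u e in auto)
  also have "(\<Sum>s<n. e s + 2 * c) \<le> (\<Sum>s<t. e s) + 2 * c * real t"
    using e[of n] c by (simp add: n sum.distrib algebra_simps)
  then have "u * ((real 0 + 1) * e 0) + (u - 1) * (\<Sum>s<n. e s + 2 * c)
      \<le> u * e 0 + (u - 1) * ((\<Sum>s<t. e s) + 2 * c * real t)"
    using u by (simp add: mult_left_mono)
  also have "\<dots> \<le> u * e 0 + (u - 1) * ((u * e 0 + (u - 1) * (2 * c * h)) + 2 * c * real t)"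
    using sum_e u by (intro add_left_mono mult_left_mono) auto
  also have "\<dots> = u\<^sup>2 * e 0 + 2 * c * ((u - 1) * ((u - 1) * h)) + 2 * c * (u - 1) * real t"
    by (simp add: algebra_simps power2_eq_square)
  also have "\<dots> \<le> u\<^sup>2 * e 0 + 2 * c * ((u - 1) * real t + u ^ 3) + 2 * c * (u - 1) * real t"
    using h_bound c by (intro add_right_mono add_left_mono mult_left_mono) auto
  also have "\<dots> \<le> 4 * real t * c * (u - 1) + u\<^sup>2 * (e 0 + 16 * c * u)"
  proof -
    \<comment> \<open>The argument yields \<open>2 * c * u ^ 3\<close>; the stated bound allows
      \<open>16 * c * u ^ 3\<close>.\<close>
    have "0 \<le> 14 * c * u ^ 3" using c u by simp
    then show ?thesis by (simp add: algebra_simps power2_eq_square power3_eq_cube)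
  qed
  finally show ?thesis by (simp add: n)
qed

text \<open>Multiplied by \<open>(s + 1) * (s + 2)\<close>, the contracted gap becomes
  \<open>s * (s + 1) * \<epsilon> s\<close>, so the recurrence telescopes. The weight vanishes at
  \<open>s = 0\<close>, which removes the initial gap.\<close>

lemma gap_bound:
  fixes \<epsilon> e :: "nat \<Rightarrow> real"
  assumes N: "0 \<le> N"
    and rec: "\<And>s. s < t \<Longrightarrow> \<epsilon> (Suc s) \<le> (1 - 2 / (real s + 2)) * \<epsilon> s
      + 2 / (real s + 2) * B * e s + (2 / (real s + 2))\<^sup>2 * N / 2"
  shows "real t * (real t + 1) * \<epsilon> t \<le> 2 * B * (\<Sum>s<t. (real s + 1) * e s) + 2 * real t * N"
  using rec
proof (induction t)
  case (Suc t)
  define q where "q = real t"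
  have q: "0 \<le> q" by (simp add: q_def)
  have "(q + 1) * (q + 2) * \<epsilon> (Suc t) \<le> (q + 1) * (q + 2) * ((1 - 2 / (q + 2)) * \<epsilon> t
      + 2 / (q + 2) * B * e t + (2 / (q + 2))\<^sup>2 * N / 2)"
    unfolding q_def by (intro mult_left_mono Suc.prems) auto
  also have "\<dots> = q * (q + 1) * \<epsilon> t + 2 * B * ((q + 1) * e t) + 2 * N * ((q + 1) / (q + 2))"
    using q by (simp add: divide_simps power2_eq_square) (simp add: algebra_simps)
  also have "\<dots> \<le> q * (q + 1) * \<epsilon> t + 2 * B * ((q + 1) * e t) + 2 * N * 1"
    using q N by (intro add_left_mono mult_left_mono) auto
  finally show ?case
    using Suc.IH Suc.prems by (simp add: q_def algebra_simps)
qed simp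

section \<open>Measurability and independence\<close>

lemma borel_measurable_vec_nth:
  fixes h :: "'w \<Rightarrow> ('v::euclidean_space)^'k"
  shows "h \<in> borel_measurable N \<Longrightarrow> (\<lambda>\<omega>. h \<omega> $ i) \<in> borel_measurable N"
  by (erule measurable_compose[OF _ borel_measurable_continuous_onI]) (intro continuous_intros)

lemma borel_measurable_vecI:
  fixes h :: "'w \<Rightarrow> real^'k"
  assumes "\<And>i. (\<lambda>\<omega>. h \<omega> $ i) \<in> borel_measurable N"
  shows "h \<in> borel_measurable N"
  using assms by (subst borel_measurable_euclidean_space) (auto simp: Basis_vec_def inner_axis)

lemma borel_measurable_deriv_convex:
  fixes h :: "real \<Rightarrow> real"
  assumes "convex_on UNIV h" and "\<And>r. h differentiable (at r)"
  shows "deriv h \<in> borel_measurable borel"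
  by (intro borel_measurable_mono mono_deriv_convex assms)

text \<open>Turns independence of event families into a product rule: \<open>Z\<close> is known
  before the draw, \<open>X\<close> is the draw. The events of \<open>Z\<close> and of
  \<open>\<phi> (X \<omega>)\<close> lie in the two independent families.\<close>

lemma (in prob_space) expectation_mult_indep:
  fixes \<phi> :: "'c \<Rightarrow> real" and Z :: "'a \<Rightarrow> real"
  assumes sub: "subalgebra M N"
    and indep: "indep_set (sets N) {X -` S \<inter> space M | S. True}"
    and Z: "Z \<in> borel_measurable N" "integrable M Z"
    and X: "X \<in> M \<rightarrow>\<^sub>M count_space UNIV" "integrable M (\<lambda>\<omega>. \<phi> (X \<omega>))"
  shows "expectation (\<lambda>\<omega>. Z \<omega> * \<phi> (X \<omega>)) = expectation Z * expectation (\<lambda>\<omega>. \<phi> (X \<omega>))"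
proof -
  have space_N: "space N = space M"
    using sub by (simp add: subalgebra_def)
  have "sigma_sets (space N) {Z -` A \<inter> space M | A. A \<in> sets borel} \<subseteq> sets N"
    using measurable_sets[OF Z(1)] by (intro sets.sigma_sets_subset) (auto simp: space_N)
  then have Z_sets: "sigma_sets (space M) {Z -` A \<inter> space M | A. A \<in> sets borel} \<subseteq> sets N"
    by (simp add: space_N)
  \<comment> \<open>Every set is measurable in \<open>count_space UNIV\<close>, so the preimages
    under \<open>X\<close> already form a sigma-algebra, and the events generated by
    \<open>\<phi> (X \<omega>)\<close> stay among them.\<close>
  let ?V = "vimage_algebra (space M) X (count_space UNIV)"
  have sets_V: "sets ?V = {X -` S \<inter> space M | S. True}"
    by (subst sets_vimage_algebra2) auto
  have "sigma_sets (space ?V) {(\<lambda>\<omega>. \<phi> (X \<omega>)) -` A \<inter> space M | A. A \<in> sets borel} \<subseteq> sets ?V"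
  proof (rule sets.sigma_sets_subset, clarify)
    fix A :: "real set"
    have "(\<lambda>\<omega>. \<phi> (X \<omega>)) -` A \<inter> space M = X -` (\<phi> -` A) \<inter> space M"
      by auto
    then show "(\<lambda>\<omega>. \<phi> (X \<omega>)) -` A \<inter> space M \<in> sets ?V"
      unfolding sets_V by blast
  qed
  then have X_sets: "sigma_sets (space M) {(\<lambda>\<omega>. \<phi> (X \<omega>)) -` A \<inter> space M | A. A \<in> sets borel}
      \<subseteq> {X -` S \<inter> space M | S. True}"
    by (simp add: sets_V)
  have "indep_var borel Z borel (\<lambda>\<omega>. \<phi> (X \<omega>))"
    unfolding indep_var_eq
  proof (intro conjI)
    show "indep_set (sigma_sets (space M) {Z -` A \<inter> space M | A. A \<in> sets borel})
        (sigma_sets (space M) {(\<lambda>\<omega>. \<phi> (X \<omega>)) -` A \<inter> space M | A. A \<in> sets borel})"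
      using indep Z_sets X_sets unfolding indep_sets2_eq by (meson order_trans subsetD)
  qed (use Z(2) X(2) in auto)
  then show ?thesis
    by (rule indep_var_lebesgue_integral[OF _ Z(2) X(2)])
qed

text \<open>A shift by one that stores the initial value 0 at index 0, so that
  \<open>previous \<alpha> s\<close> is what is known before the batch of iteration \<open>s\<close>
  is drawn.\<close>

definition previous :: "(nat \<Rightarrow> 'w \<Rightarrow> 'v::zero) \<Rightarrow> nat \<Rightarrow> 'w \<Rightarrow> 'v" where
  "previous h s = (case s of 0 \<Rightarrow> (\<lambda>_. 0) | Suc r \<Rightarrow> h r)"

lemma previous_simps [simp]: "previous h 0 = (\<lambda>_. 0)" "previous h (Suc r) = h r"
  by (simp_all add: previous_def)

section \<open>Progress along a run\<close>

text \<open>The choice \<open>2 / (s + 2)\<close> for \<open>\<gamma> s\<close> is postponed to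
  \<open>expected_gap_bound\<close>; the estimates for a single iteration hold for any step-size
  bounds.\<close>

locale adacsfw_smooth = adacsfw M F C a f T b K lo hi \<eta> \<gamma> x0 batch \<alpha> g G H v y \<gamma>' x
  for M :: "'w measure" and F :: "nat \<Rightarrow> 'w measure"
    and C :: "(real^'n) set"
    and a :: "'m::finite \<Rightarrow> real^'n"
    and f :: "'m \<Rightarrow> real \<Rightarrow> real"
    and T b K :: nat
    and lo hi \<eta> \<gamma> :: "nat \<Rightarrow> real"
    and x0 :: "real^'n"
    and batch :: "nat \<Rightarrow> 'w \<Rightarrow> 'm list"
    and \<alpha> :: "nat \<Rightarrow> 'w \<Rightarrow> real^'m"
    and g :: "nat \<Rightarrow> 'w \<Rightarrow> real^'n"
    and G H :: "nat \<Rightarrow> 'w \<Rightarrow> real^'n^'n"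
    and v y :: "nat \<Rightarrow> nat \<Rightarrow> 'w \<Rightarrow> real^'n"
    and \<gamma>' :: "nat \<Rightarrow> nat \<Rightarrow> 'w \<Rightarrow> real"
    and x :: "nat \<Rightarrow> 'w \<Rightarrow> real^'n" +
  fixes L :: real
  assumes compact_C: "compact C" and convex_C: "convex C"
    and differentiable: "\<And>i r. f i differentiable (at r)"
    and convex_f: "\<And>i. convex_on UNIV (f i)"
    and lipschitz: "\<And>i r s. r \<in> (\<lambda>z. a i \<bullet> z) ` C \<Longrightarrow> s \<in> (\<lambda>z. a i \<bullet> z) ` C \<Longrightarrow>
      \<bar>deriv (f i) r - deriv (f i) s\<bar> \<le> L * \<bar>r - s\<bar>"
    and learning_rate:
      "\<And>s. s < T \<Longrightarrow> \<eta> s = real CARD('m) * lo s / (L * (spectral_norm (data_matrix a))\<^sup>2)"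
begin

abbreviation "A \<equiv> data_matrix a"
abbreviation "\<sigma> \<equiv> spectral_norm A"
abbreviation "D1 \<equiv> image_diameter l1norm A C"
abbreviation "Dinf \<equiv> image_diameter infnorm A C"
abbreviation "D2 \<equiv> diameter C"
abbreviation "obj \<equiv> objective a f"
abbreviation "df \<equiv> deriv_vec a f"
abbreviation "grad s k \<omega> \<equiv> model_grad (g s \<omega>) (\<eta> s) (H s \<omega>) (x s \<omega>) (y s k \<omega>)"

section \<open>Constants of the run\<close>

lemma m_pos: "0 < real CARD('m)"
  by simp

lemma norm_data_le: "norm (A *v u) \<le> \<sigma> * norm u"
  unfolding spectral_norm_def by (intro onorm matrix_vector_mul_bounded_linear)

text \<open>The learning rate is a positive quotient with positive numerator, which forces its
  denominator to be positive; a zero denominator would give the value 0.\<close>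

lemma curvature_pos: "s < T \<Longrightarrow> 0 < L * \<sigma>\<^sup>2"
  using learning_rate[of s] learning_rate_pos[of s] clip_bounds[of s] m_pos
  by (metis mult_pos_pos zero_less_divide_iff order_less_asym)

lemma L_pos: "s < T \<Longrightarrow> 0 < L"
  using curvature_pos by (auto simp: zero_less_mult_iff)

lemma inverse_learning_rate: "s < T \<Longrightarrow> 1 / (2 * \<eta> s) = L * \<sigma>\<^sup>2 / (2 * real CARD('m) * lo s)"
  by (simp add: learning_rate)

lemma lo_pos: "s < T \<Longrightarrow> 0 < lo s"
  and lo_le_hi: "s < T \<Longrightarrow> lo s \<le> hi s"
  using clip_bounds[of s] by auto

lemma clip_bounds_initial: "s \<le> T \<Longrightarrow> lo 0 \<le> lo s \<and> hi s \<le> hi 0"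
proof (induction s)
  case (Suc s)
  with clip_bounds[of s] show ?case by auto
qed simp

lemma clip_ratio_le: "s < T \<Longrightarrow> hi s / lo s \<le> hi 0 / lo 0"
  using clip_bounds_initial[of s] lo_pos[of s] lo_le_hi[of s] lo_pos[of 0]
  by (intro frac_le) auto

lemma C_nonempty: "C \<noteq> {}"
  using start_point by auto

lemma norm_diff_le_diameter: "z \<in> C \<Longrightarrow> w \<in> C \<Longrightarrow> norm (w - z) \<le> D2"
  using diameter_bounded_bound[OF compact_imp_bounded[OF compact_C], of w z] by (simp add: dist_norm)

lemma continuous_l1norm: "continuous_on UNIV l1norm"
  unfolding l1norm_def by (intro continuous_intros)

lemma l1norm_le_D1: "z \<in> C \<Longrightarrow> w \<in> C \<Longrightarrow> l1norm (A *v (w - z)) \<le> D1"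
  by (rule le_image_diameter[OF compact_C continuous_l1norm])

lemma infnorm_le_Dinf: "z \<in> C \<Longrightarrow> w \<in> C \<Longrightarrow> infnorm (A *v (w - z)) \<le> Dinf"
  by (intro le_image_diameter[OF compact_C] continuous_intros)

lemma D1_nonneg: "0 \<le> D1"
  using l1norm_le_D1[OF start_point start_point] l1norm_nonneg order_trans by blast

lemma Dinf_nonneg: "0 \<le> Dinf"
  using infnorm_le_Dinf[OF start_point start_point] infnorm_pos_le order_trans by blast

context
  fixes s \<omega>
  assumes s: "s < T" and \<omega>: "\<omega> \<in> space M"
begin

lemma H_symmetric: "u \<bullet> (H s \<omega> *v w) = w \<bullet> (H s \<omega> *v u)"
  unfolding H_clip[OF s \<omega>] by (rule clip_diag_symmetric)

lemma H_bounds: "lo s * (norm u)\<^sup>2 \<le> u \<bullet> (H s \<omega> *v u)" "u \<bullet> (H s \<omega> *v u) \<le> hi s * (norm u)\<^sup>2"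
  unfolding H_clip[OF s \<omega>] by (rule clip_diag_bounds[OF lo_le_hi[OF s]])+

lemma mat_norm_H: "(mat_norm (H s \<omega>) u)\<^sup>2 = u \<bullet> (H s \<omega> *v u)"
  unfolding H_clip[OF s \<omega>] using lo_pos[OF s] lo_le_hi[OF s] by (intro mat_norm_clip_diag) auto

lemma v_in_C: "k < K \<Longrightarrow> v s k \<omega> \<in> C"
  and v_minimal: "k < K \<Longrightarrow> w \<in> C \<Longrightarrow> grad s k \<omega> \<bullet> v s k \<omega> \<le> grad s k \<omega> \<bullet> w"
  using v_minimiser[OF s _ \<omega>, of k] by (auto simp: is_arg_min_def not_less)

lemma step_size_bounds:
  assumes "k < K" "y s k \<omega> \<in> C"
  shows "0 \<le> \<gamma>' s k \<omega>" "\<gamma>' s k \<omega> \<le> \<gamma> s"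
  using v_minimal[OF assms] step_bound[OF s] learning_rate_pos[OF s] step_size[OF s assms(1) \<omega>]
  by (auto simp: inner_diff_right intro!: divide_nonneg_nonneg)

lemma inner_iterate_in_C:
  assumes "x s \<omega> \<in> C"
  shows "k \<le> K \<Longrightarrow> y s k \<omega> \<in> C"
proof (induction k)
  case 0
  with assms show ?case by (simp add: inner_init[OF s \<omega>])
next
  case (Suc k)
  then have k: "k < K" and yk: "y s k \<omega> \<in> C" by auto
  have "(1 - \<gamma>' s k \<omega>) *\<^sub>R y s k \<omega> + \<gamma>' s k \<omega> *\<^sub>R v s k \<omega> \<in> C"
    using step_size_bounds[OF k yk] step_bound[OF s] yk v_in_C[OF k]
    by (intro convexD[OF convex_C]) auto
  then show ?case
    by (simp add: inner_step[OF s k \<omega>] algebra_simps)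
qed

text \<open>The step-size is the clipped minimiser of the model along the segment, so every
  \<open>r\<close> up to \<open>\<gamma> s\<close> is a valid competitor. Later \<open>r = 0\<close>
  gives monotonicity and \<open>r = \<gamma> s\<close> gives the Frank-Wolfe decrease.\<close>

lemma inner_progress:
  assumes "x s \<omega> \<in> C" "k < K" "0 \<le> r" "r \<le> \<gamma> s"
  shows "model (g s \<omega>) (\<eta> s) (H s \<omega>) (x s \<omega>) (y s (Suc k) \<omega>)
    \<le> model (g s \<omega>) (\<eta> s) (H s \<omega>) (x s \<omega>) (y s k \<omega>)
      + r * (grad s k \<omega> \<bullet> (v s k \<omega> - y s k \<omega>))
      + r\<^sup>2 * ((v s k \<omega> - y s k \<omega>) \<bullet> (H s \<omega> *v (v s k \<omega> - y s k \<omega>))) / (2 * \<eta> s)"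
proof -
  have yk: "y s k \<omega> \<in> C"
    using inner_iterate_in_C assms(1,2) by simp
  define d where "d = v s k \<omega> - y s k \<omega>"
  define p where "p = grad s k \<omega> \<bullet> (y s k \<omega> - v s k \<omega>)"
  define q where "q = d \<bullet> (H s \<omega> *v d)"
  have p: "0 \<le> p"
    using v_minimal[OF assms(2) yk] by (simp add: p_def inner_diff_right)
  have q: "lo s * (norm d)\<^sup>2 \<le> q"
    unfolding q_def by (rule H_bounds)
  have "0 \<le> lo s * (norm d)\<^sup>2"
    using lo_pos[OF s] by simp
  with q have q_nonneg: "0 \<le> q" by linarith
  \<comment> \<open>\<open>H\<close> dominates \<open>lo s > 0\<close>, so a vanishing quadratic
    form means \<open>v\<close> equals \<open>y\<close>.\<close>
  have degenerate: "p = 0" if "q = 0"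
  proof -
    have "lo s * (norm d)\<^sup>2 = 0"
      using q \<open>0 \<le> lo s * (norm d)\<^sup>2\<close> that by linarith
    then have "d = 0"
      using lo_pos[OF s] by simp
    then show ?thesis
      by (simp add: p_def d_def)
  qed
  have q_eq: "(mat_norm (H s \<omega>) (y s k \<omega> - v s k \<omega>))\<^sup>2 = q"
  proof -
    have "y s k \<omega> - v s k \<omega> = (- 1) *\<^sub>R d"
      by (simp add: d_def)
    then show ?thesis
      unfolding mat_norm_H q_def by (simp only: matrix_vector_mult_scaleR) simp
  qed
  have step: "\<gamma>' s k \<omega> = min (\<eta> s * p / q) (\<gamma> s)"
    using step_size[OF s assms(2) \<omega>] by (simp add: q_eq p_def)
  have grad_d: "grad s k \<omega> \<bullet> d = - p"
    by (simp add: d_def p_def inner_diff_right)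
  have "model (g s \<omega>) (\<eta> s) (H s \<omega>) (x s \<omega>) (y s (Suc k) \<omega>)
    = model (g s \<omega>) (\<eta> s) (H s \<omega>) (x s \<omega>) (y s k \<omega>) - \<gamma>' s k \<omega> * p + (\<gamma>' s k \<omega>)\<^sup>2 * q / (2 * \<eta> s)"
    by (simp add: inner_step[OF s assms(2) \<omega>] model_along_line[OF H_symmetric] d_def[symmetric]
        grad_d q_def)
  also have "\<dots> \<le> model (g s \<omega>) (\<eta> s) (H s \<omega>) (x s \<omega>) (y s k \<omega>) - r * p + r\<^sup>2 * q / (2 * \<eta> s)"
    using clipped_line_search[OF p q_nonneg degenerate learning_rate_pos[OF s] assms(3,4)]
    by (simp add: step)
  finally show ?thesis
    by (simp add: d_def[symmetric] grad_d q_def)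
qed

lemma outer_progress:
  assumes "x s \<omega> \<in> C" "z \<in> C"
  shows "model (g s \<omega>) (\<eta> s) (H s \<omega>) (x s \<omega>) (x (Suc s) \<omega>)
    \<le> \<gamma> s * (g s \<omega> \<bullet> (z - x s \<omega>)) + (\<gamma> s)\<^sup>2 * (hi s * D2\<^sup>2) / (2 * \<eta> s)"
proof -
  let ?Q = "model (g s \<omega>) (\<eta> s) (H s \<omega>) (x s \<omega>)"
  define d where "d = v s 0 \<omega> - x s \<omega>"
  have K: "0 < K" using inner_iterations by simp
  \<comment> \<open>Competing with step-size 0 shows that no inner iteration increases the
    model.\<close>
  have later: "?Q (y s (Suc k) \<omega>) \<le> ?Q (y s 1 \<omega>)" if "k < K" for k
    using that
  proof (induction k)
    case (Suc k)
    with inner_progress[OF assms(1) Suc.prems order_refl] step_bound[OF s] show ?case by simp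
  qed simp
  have "?Q (x (Suc s) \<omega>) \<le> ?Q (y s 1 \<omega>)"
    using later[of "K - 1"] K by (simp add: outer_step[OF s \<omega>])
  \<comment> \<open>At \<open>y s 0 \<omega> = x s \<omega>\<close> the model is 0 and its gradient
    is \<open>g s \<omega>\<close>. Hence \<open>v s 0 \<omega>\<close> minimises the estimated
    gradient over \<open>C\<close>, and any \<open>z\<close> may replace it below.\<close>
  also have "\<dots> \<le> \<gamma> s * (g s \<omega> \<bullet> d) + (\<gamma> s)\<^sup>2 * (d \<bullet> (H s \<omega> *v d)) / (2 * \<eta> s)"
    using inner_progress[OF assms(1) K _ order_refl] step_bound[OF s]
    by (simp add: inner_init[OF s \<omega>] model_def model_grad_def d_def)
  also have "\<dots> \<le> \<gamma> s * (g s \<omega> \<bullet> (z - x s \<omega>)) + (\<gamma> s)\<^sup>2 * (hi s * D2\<^sup>2) / (2 * \<eta> s)"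
  proof (intro add_mono divide_right_mono mult_left_mono)
    show "g s \<omega> \<bullet> d \<le> g s \<omega> \<bullet> (z - x s \<omega>)"
      using v_minimal[OF K assms(2)]
      by (simp add: inner_init[OF s \<omega>] model_grad_def d_def inner_diff_right)
    have "d \<bullet> (H s \<omega> *v d) \<le> hi s * (norm d)\<^sup>2"
      by (rule H_bounds)
    also have "\<dots> \<le> hi s * D2\<^sup>2"
      using norm_diff_le_diameter[OF assms(1) v_in_C[OF K]] lo_pos[OF s] lo_le_hi[OF s]
      by (intro mult_left_mono power_mono) (auto simp: d_def)
    finally show "d \<bullet> (H s \<omega> *v d) \<le> hi s * D2\<^sup>2" .
  qed (use step_bound[OF s] learning_rate_pos[OF s] in auto)
  finally show ?thesis .
qed

text \<open>Each of the \<open>K\<close> inner steps covers at most the fraction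
  \<open>\<gamma> s\<close> of a diameter. The norm is left abstract so that both
  \<open>infnorm\<close> and \<open>l1norm\<close> are covered.\<close>

lemma displacement:
  assumes "x s \<omega> \<in> C"
    and triangle: "\<And>u w. N (u + w) \<le> N u + N w"
    and scale: "\<And>r u. N (r *\<^sub>R u) = \<bar>r\<bar> * N u"
    and bound: "\<And>z w. z \<in> C \<Longrightarrow> w \<in> C \<Longrightarrow> N (A *v (w - z)) \<le> D"
  shows "N (A *v (x (Suc s) \<omega> - x s \<omega>)) \<le> real K * \<gamma> s * D"
proof -
  have N0: "N 0 = 0"
    using scale[of 0 0] by simp
  with bound[OF start_point start_point] have D: "0 \<le> D" by simp
  have "N (A *v (y s k \<omega> - x s \<omega>)) \<le> real k * \<gamma> s * D" if "k \<le> K" for k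
    using that
  proof (induction k)
    case 0
    then show ?case by (simp add: inner_init[OF s \<omega>] N0)
  next
    case (Suc k)
    then have k: "k < K" by simp
    have yk: "y s k \<omega> \<in> C" using inner_iterate_in_C assms(1) k by simp
    let ?d = "A *v (v s k \<omega> - y s k \<omega>)"
    have "A *v (y s (Suc k) \<omega> - x s \<omega>) = A *v ((y s k \<omega> - x s \<omega>) + \<gamma>' s k \<omega> *\<^sub>R (v s k \<omega> - y s k \<omega>))"
      by (simp add: inner_step[OF s k \<omega>] algebra_simps)
    also have "\<dots> = A *v (y s k \<omega> - x s \<omega>) + \<gamma>' s k \<omega> *\<^sub>R ?d"
      by (simp only: matrix_vector_right_distrib matrix_vector_mult_scaleR)
    also have "N \<dots> \<le> N (A *v (y s k \<omega> - x s \<omega>)) + \<gamma>' s k \<omega> * N ?d"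
      using triangle[of "A *v (y s k \<omega> - x s \<omega>)" "\<gamma>' s k \<omega> *\<^sub>R ?d"] step_size_bounds[OF k yk]
      by (simp add: scale)
    also have "\<gamma>' s k \<omega> * N ?d \<le> \<gamma>' s k \<omega> * D"
      using step_size_bounds[OF k yk] bound[OF yk v_in_C[OF k]] by (intro mult_left_mono)
    also have "\<dots> \<le> \<gamma> s * D"
      using step_size_bounds[OF k yk] D by (intro mult_right_mono)
    finally show ?case
      using Suc by (simp add: algebra_simps)
  qed
  from this[of K] show ?thesis
    by (simp add: outer_step[OF s \<omega>])
qed

end

lemma x_in_C: "s \<le> T \<Longrightarrow> \<omega> \<in> space M \<Longrightarrow> x s \<omega> \<in> C"
proof (induction s)
  case 0
  then show ?case by (simp add: init start_point)
next
  case (Suc s)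
  then show ?case using inner_iterate_in_C[of s \<omega> K] by (simp add: outer_step)
qed

text \<open>A repeated index would break this representation of the gradient estimator.\<close>

lemma estimator_eq:
  assumes \<omega>: "\<omega> \<in> space M" and batches: "\<And>s. s < T \<Longrightarrow> batch s \<omega> \<in> batches b"
  shows "s < T \<Longrightarrow> g s \<omega> = (\<Sum>i\<in>UNIV. \<alpha> s \<omega> $ i *\<^sub>R a i)"
proof -
  have increment: "(\<Sum>j<b. (\<alpha> s \<omega> $ (batch s \<omega> ! j) - p $ (batch s \<omega> ! j)) *\<^sub>R a (batch s \<omega> ! j))
      = (\<Sum>i\<in>UNIV. (\<alpha> s \<omega> $ i - p $ i) *\<^sub>R a i)"
    if s: "s < T" and p: "p = (if s = 0 then 0 else \<alpha> (s - 1) \<omega>)" for s p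
  proof -
    \<comment> \<open>Distinctness makes positions in the batch correspond one-to-one to sampled
      indices.\<close>
    have "bij_betw ((!) (batch s \<omega>)) {..<b} (set (batch s \<omega>))"
      using batches[OF s] by (intro bij_betw_nth) (auto simp: batches_def)
    then have "(\<Sum>j<b. (\<alpha> s \<omega> $ (batch s \<omega> ! j) - p $ (batch s \<omega> ! j)) *\<^sub>R a (batch s \<omega> ! j))
        = (\<Sum>i\<in>set (batch s \<omega>). (\<alpha> s \<omega> $ i - p $ i) *\<^sub>R a i)"
      by (rule sum.reindex_bij_betw)
    \<comment> \<open>Entries outside the batch keep their old value and contribute 0.\<close>
    also have "\<dots> = (\<Sum>i\<in>UNIV. (\<alpha> s \<omega> $ i - p $ i) *\<^sub>R a i)"
      by (intro sum.mono_neutral_left) (auto simp: \<alpha>_update[OF s \<omega>] p)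
    finally show ?thesis .
  qed
  show "s < T \<Longrightarrow> g s \<omega> = (\<Sum>i\<in>UNIV. \<alpha> s \<omega> $ i *\<^sub>R a i)"
  proof (induction s)
    case 0
    with increment[of 0 0] show ?case
      by (simp add: g_update[OF _ \<omega>])
  next
    case (Suc s)
    with increment[of "Suc s" "\<alpha> s \<omega>"] show ?case
      by (simp add: g_update[OF _ \<omega>] scaleR_diff_left sum_subtractf)
  qed
qed

text \<open>The estimation error enters twice: paired with the actual displacement, of size at most
  \<open>K * \<gamma> s * Dinf\<close>, and paired with the comparison direction towards
  \<open>z\<close>, scaled by \<open>\<gamma> s\<close>. Together they give the factor
  \<open>K + 1\<close>.\<close>

lemma gap_step:
  assumes \<omega>: "\<omega> \<in> space M" and batches: "\<And>s. s < T \<Longrightarrow> batch s \<omega> \<in> batches b"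
    and s: "s < T" and z: "z \<in> C"
  shows "obj (x (Suc s) \<omega>) - obj z \<le> (1 - \<gamma> s) * (obj (x s \<omega>) - obj z)
    + \<gamma> s * ((real K + 1) * Dinf) * l1norm (df (x s \<omega>) - \<alpha> s \<omega>)
    + (\<gamma> s)\<^sup>2 * (L * (hi 0 / lo 0 * \<sigma>\<^sup>2 * D2\<^sup>2 / real CARD('m))) / 2"
proof -
  define E where "E = l1norm (df (x s \<omega>) - \<alpha> s \<omega>)"
  define u where "u = x (Suc s) \<omega> - x s \<omega>"
  have xC: "x s \<omega> \<in> C" "x (Suc s) \<omega> \<in> C"
    using x_in_C \<omega> s by auto
  have E: "0 \<le> E" unfolding E_def by (rule l1norm_nonneg)
  have \<gamma>: "0 \<le> \<gamma> s" using step_bound[OF s] by simp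
  have g_inner: "g s \<omega> \<bullet> w = \<alpha> s \<omega> \<bullet> (A *v w)" for w
    by (simp add: estimator_eq[OF \<omega> batches s] inner_sum_left inner_vec_def[of "\<alpha> s \<omega>"])
  \<comment> \<open>The learning rate is chosen so that
    \<open>L * \<sigma>\<^sup>2 / m = lo s / \<eta> s\<close>; since \<open>H\<close> dominates
    \<open>lo s\<close>, the quadratic term of the model majorises that of the objective.\<close>
  have "L / (2 * real CARD('m)) * (norm (A *v u))\<^sup>2 \<le> L / (2 * real CARD('m)) * (\<sigma> * norm u)\<^sup>2"
    using L_pos[OF s] norm_data_le[of u] by (intro mult_left_mono power_mono) auto
  also have "\<dots> = 1 / (2 * \<eta> s) * (lo s * (norm u)\<^sup>2)"
    using lo_pos[OF s] by (simp add: inverse_learning_rate[OF s] power_mult_distrib)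
  also have "\<dots> \<le> 1 / (2 * \<eta> s) * (u \<bullet> (H s \<omega> *v u))"
    using learning_rate_pos[OF s] H_bounds(1)[OF s \<omega>] by (intro mult_left_mono) auto
  finally have quad: "L / (2 * real CARD('m)) * (norm (A *v u))\<^sup>2 \<le> 1 / (2 * \<eta> s) * (u \<bullet> (H s \<omega> *v u))" .
  have "obj (x (Suc s) \<omega>) \<le> obj (x s \<omega>) + df (x s \<omega>) \<bullet> (A *v u) + L / (2 * real CARD('m)) * (norm (A *v u))\<^sup>2"
    unfolding u_def by (rule objective_upper_bound[OF differentiable lipschitz convex_C xC])
  also have "\<dots> \<le> obj (x s \<omega>) + (df (x s \<omega>) - \<alpha> s \<omega>) \<bullet> (A *v u)
      + model (g s \<omega>) (\<eta> s) (H s \<omega>) (x s \<omega>) (x (Suc s) \<omega>)"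
    using quad by (simp add: model_def u_def[symmetric] g_inner inner_diff_left)
  also have "(df (x s \<omega>) - \<alpha> s \<omega>) \<bullet> (A *v u) \<le> E * (real K * \<gamma> s * Dinf)"
  proof -
    have "infnorm (A *v u) \<le> real K * \<gamma> s * Dinf"
      unfolding u_def
      by (rule displacement[OF s \<omega> xC(1) infnorm_triangle infnorm_mul infnorm_le_Dinf])
    from mult_left_mono[OF this E] show ?thesis
      using inner_le_l1norm_infnorm[of "df (x s \<omega>) - \<alpha> s \<omega>" "A *v u"] unfolding E_def
      by linarith
  qed
  also have "model (g s \<omega>) (\<eta> s) (H s \<omega>) (x s \<omega>) (x (Suc s) \<omega>)
      \<le> \<gamma> s * (obj z - obj (x s \<omega>) + E * Dinf) + (\<gamma> s)\<^sup>2 * (L * (hi 0 / lo 0 * \<sigma>\<^sup>2 * D2\<^sup>2 / real CARD('m))) / 2"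
  proof -
    have "(df (x s \<omega>) - \<alpha> s \<omega>) \<bullet> (A *v (x s \<omega> - z)) \<le> E * Dinf"
      using inner_le_l1norm_infnorm[of "df (x s \<omega>) - \<alpha> s \<omega>" "A *v (x s \<omega> - z)"]
        mult_left_mono[OF infnorm_le_Dinf[OF z xC(1)] E] unfolding E_def by linarith
    moreover have "A *v (x s \<omega> - z) = - (A *v (z - x s \<omega>))"
      by (simp add: matrix_vector_mult_diff_distrib)
    moreover have "df (x s \<omega>) \<bullet> (A *v (z - x s \<omega>)) \<le> obj z - obj (x s \<omega>)"
      using objective_above_tangent[of f a "x s \<omega>" z] differentiable convex_f by simp
    ultimately have "g s \<omega> \<bullet> (z - x s \<omega>) \<le> obj z - obj (x s \<omega>) + E * Dinf"
      by (simp add: g_inner inner_diff_left)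
    then have "\<gamma> s * (g s \<omega> \<bullet> (z - x s \<omega>)) \<le> \<gamma> s * (obj z - obj (x s \<omega>) + E * Dinf)"
      using \<gamma> by (rule mult_left_mono)
    moreover have "(\<gamma> s)\<^sup>2 * (hi s * D2\<^sup>2) / (2 * \<eta> s)
        = (\<gamma> s)\<^sup>2 * (hi s * D2\<^sup>2) * (L * \<sigma>\<^sup>2 / (2 * real CARD('m) * lo s))"
      unfolding inverse_learning_rate[OF s, symmetric] by simp
    moreover have "\<dots> = (hi s / lo s) * ((\<gamma> s)\<^sup>2 * L * \<sigma>\<^sup>2 * D2\<^sup>2 / (2 * real CARD('m)))"
      by (simp add: mult_ac)
    moreover have "\<dots> \<le> (hi 0 / lo 0) * ((\<gamma> s)\<^sup>2 * L * \<sigma>\<^sup>2 * D2\<^sup>2 / (2 * real CARD('m)))"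
      using clip_ratio_le[OF s] L_pos[OF s] by (intro mult_right_mono) auto
    moreover have "\<dots> = (\<gamma> s)\<^sup>2 * (L * (hi 0 / lo 0 * \<sigma>\<^sup>2 * D2\<^sup>2 / real CARD('m))) / 2"
      by (simp add: mult_ac)
    ultimately show ?thesis
      using outer_progress[OF s \<omega> xC(1) z] by linarith
  qed
  finally show ?thesis
    unfolding E_def[symmetric] by (simp add: algebra_simps)
qed

text \<open>Entrywise, \<open>df\<close> is Lipschitz with constant \<open>L / m\<close> in the
  coordinates of \<open>A *v x\<close>, and these move by at most \<open>K * \<gamma> s * D1\<close>
  in total.\<close>

lemma deriv_vec_step:
  assumes \<omega>: "\<omega> \<in> space M" and s: "s < T"
  shows "l1norm (df (x (Suc s) \<omega>) - df (x s \<omega>)) \<le> real K * L * D1 / real CARD('m) * \<gamma> s"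
proof -
  define u where "u = x (Suc s) \<omega> - x s \<omega>"
  have xC: "x s \<omega> \<in> C" "x (Suc s) \<omega> \<in> C"
    using x_in_C \<omega> s by auto
  have "\<bar>(df (x (Suc s) \<omega>) - df (x s \<omega>)) $ i\<bar> \<le> L / real CARD('m) * \<bar>(A *v u) $ i\<bar>" for i
  proof -
    have "\<bar>deriv (f i) (a i \<bullet> x (Suc s) \<omega>) - deriv (f i) (a i \<bullet> x s \<omega>)\<bar> \<le> L * \<bar>a i \<bullet> u\<bar>"
      using lipschitz[of "a i \<bullet> x (Suc s) \<omega>" i "a i \<bullet> x s \<omega>"] xC by (auto simp: u_def inner_diff_right)
    then show ?thesis
      by (simp add: deriv_vec_def diff_divide_distrib[symmetric] divide_right_mono)
  qed
  then have "l1norm (df (x (Suc s) \<omega>) - df (x s \<omega>)) \<le> (\<Sum>i\<in>UNIV. L / real CARD('m) * \<bar>(A *v u) $ i\<bar>)"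
    unfolding l1norm_def by (rule sum_mono)
  also have "\<dots> = L / real CARD('m) * l1norm (A *v u)"
    by (simp add: l1norm_def sum_distrib_left)
  also have "l1norm (A *v u) \<le> real K * \<gamma> s * D1"
    unfolding u_def
    by (rule displacement[OF s \<omega> xC(1) l1norm_triangle l1norm_scaleR l1norm_le_D1])
  then have "L / real CARD('m) * l1norm (A *v u) \<le> L / real CARD('m) * (real K * \<gamma> s * D1)"
    using L_pos[OF s] by (intro mult_left_mono) auto
  finally show ?thesis
    by (simp add: mult_ac)
qed

section \<open>The error of the gradient estimator\<close>

lemma \<alpha>_eq: "s < T \<Longrightarrow> \<omega> \<in> space M \<Longrightarrow>
    \<alpha> s \<omega> $ i = (if i \<in> set (batch s \<omega>) then df (x s \<omega>) $ i else previous \<alpha> s \<omega> $ i)"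
  using \<alpha>_update[of s \<omega> i] by (cases s) (simp_all add: deriv_vec_def)

lemma g_eq: "s < T \<Longrightarrow> \<omega> \<in> space M \<Longrightarrow> g s \<omega> = previous g s \<omega>
    + (\<Sum>j<b. (\<alpha> s \<omega> $ (batch s \<omega> ! j) - previous \<alpha> s \<omega> $ (batch s \<omega> ! j)) *\<^sub>R a (batch s \<omega> ! j))"
  using g_update[of s \<omega>] by (cases s) simp_all

section \<open>Measurability of the iterates\<close>

lemma subalgebra_F: "r \<le> s \<Longrightarrow> subalgebra (F s) (F r)"
  using sets_F_mono by (simp add: subalgebra_def space_F)

lemma borel_measurable_deriv_vec:
  assumes "h \<in> borel_measurable N"
  shows "(\<lambda>\<omega>. df (h \<omega>)) \<in> borel_measurable N"
proof (rule borel_measurable_vecI)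
  fix i
  have "(\<lambda>\<omega>. a i \<bullet> h \<omega>) \<in> borel_measurable N"
    using assms by simp
  then have "(\<lambda>\<omega>. deriv (f i) (a i \<bullet> h \<omega>)) \<in> borel_measurable N"
    by (rule measurable_compose[OF _ borel_measurable_deriv_convex[OF convex_f differentiable]])
  then show "(\<lambda>\<omega>. df (h \<omega>) $ i) \<in> borel_measurable N"
    by (simp add: deriv_vec_def)
qed

lemma borel_measurable_H_mult:
  assumes s: "s < T" and u: "u \<in> borel_measurable (F (Suc s))"
  shows "(\<lambda>\<omega>. H s \<omega> *v u \<omega>) \<in> borel_measurable (F (Suc s))"
proof (rule borel_measurable_vecI)
  fix i
  have [measurable]: "(\<lambda>\<omega>. G s \<omega> $ i $ i) \<in> borel_measurable (F (Suc s))"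
    "(\<lambda>\<omega>. u \<omega> $ i) \<in> borel_measurable (F (Suc s))"
    by (intro borel_measurable_vec_nth G_measurable[OF s] u)+
  have "(\<lambda>\<omega>. max (lo s) (min (hi s) (G s \<omega> $ i $ i)) * u \<omega> $ i) \<in> borel_measurable (F (Suc s))"
    by measurable
  then show "(\<lambda>\<omega>. (H s \<omega> *v u \<omega>) $ i) \<in> borel_measurable (F (Suc s))"
    by (rule measurable_cong[THEN iffD1, rotated]) (simp add: space_F H_clip[OF s] clip_diag_mult_nth)
qed

text \<open>This makes the old error at \<open>x s\<close> independent of the batch of iteration
  \<open>s\<close>. The estimator takes part in the induction because the next iterate depends on
  it.\<close>

lemma borel_measurable_run:
  "s \<le> T \<Longrightarrow> x s \<in> borel_measurable (F s) \<and> previous \<alpha> s \<in> borel_measurable (F s)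
    \<and> previous g s \<in> borel_measurable (F s)"
proof (induction s)
  case 0
  have "x 0 \<in> borel_measurable (F 0)"
    by (rule measurable_cong[THEN iffD2, of _ _ "\<lambda>_. x0"]) (auto simp: space_F init)
  then show ?case by simp
next
  case (Suc s)
  then have s: "s < T" by simp
  let ?F = "F (Suc s)"
  have [measurable]: "x s \<in> borel_measurable ?F" "previous \<alpha> s \<in> borel_measurable ?F"
    "previous g s \<in> borel_measurable ?F"
    using Suc measurable_from_subalg[OF subalgebra_F[of s "Suc s"]] by auto
  note [measurable] = batch_measurable[OF s]
  have "\<alpha> s \<in> borel_measurable ?F"
  proof (rule borel_measurable_vecI)
    fix i
    have [measurable]: "(\<lambda>\<omega>. df (x s \<omega>) $ i) \<in> borel_measurable ?F"
      "(\<lambda>\<omega>. previous \<alpha> s \<omega> $ i) \<in> borel_measurable ?F"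
      by (intro borel_measurable_vec_nth borel_measurable_deriv_vec; measurable)+
    have [measurable]: "Measurable.pred ?F (\<lambda>\<omega>. i \<in> set (batch s \<omega>))"
      by (rule measurable_compose[OF batch_measurable[OF s]]) simp
    have "(\<lambda>\<omega>. if i \<in> set (batch s \<omega>) then df (x s \<omega>) $ i else previous \<alpha> s \<omega> $ i) \<in> borel_measurable ?F"
      by measurable
    then show "(\<lambda>\<omega>. \<alpha> s \<omega> $ i) \<in> borel_measurable ?F"
      by (rule measurable_cong[THEN iffD1, rotated]) (simp add: space_F \<alpha>_eq[OF s])
  qed
  note [measurable] = this
  \<comment> \<open>A batch takes countably many values, so measurability for each fixed list
    \<open>is\<close> suffices.\<close>
  have "(\<lambda>\<omega>. previous g s \<omega> + (\<Sum>j<b. (\<alpha> s \<omega> $ (is ! j) - previous \<alpha> s \<omega> $ (is ! j)) *\<^sub>R a (is ! j)))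
      \<in> borel_measurable ?F" for "is"
    by (intro borel_measurable_add borel_measurable_sum borel_measurable_scaleR borel_measurable_diff
        borel_measurable_vec_nth) measurable
  then have "(\<lambda>\<omega>. previous g s \<omega>
      + (\<Sum>j<b. (\<alpha> s \<omega> $ (batch s \<omega> ! j) - previous \<alpha> s \<omega> $ (batch s \<omega> ! j)) *\<^sub>R a (batch s \<omega> ! j)))
      \<in> borel_measurable ?F"
    by (rule measurable_compose_countable[OF _ batch_measurable[OF s]])
  then have [measurable]: "g s \<in> borel_measurable ?F"
    by (rule measurable_cong[THEN iffD1, rotated]) (simp add: space_F g_eq[OF s])
  have "y s k \<in> borel_measurable ?F" if "k \<le> K" for k
    using that
  proof (induction k)
    case 0
    show ?case
      by (rule measurable_cong[THEN iffD2, of _ _ "x s"]) (auto simp: space_F inner_init[OF s])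
  next
    case (Suc k)
    then have k: "k < K" and [measurable]: "y s k \<in> borel_measurable ?F" by auto
    note [measurable] = v_measurable[OF s k]
    have [measurable]: "(\<lambda>\<omega>. H s \<omega> *v (y s k \<omega> - x s \<omega>)) \<in> borel_measurable ?F"
      "(\<lambda>\<omega>. H s \<omega> *v (y s k \<omega> - v s k \<omega>)) \<in> borel_measurable ?F"
      by (intro borel_measurable_H_mult[OF s]; measurable)+
    have [measurable]: "(\<lambda>\<omega>. min (\<eta> s * (grad s k \<omega> \<bullet> (y s k \<omega> - v s k \<omega>))
        / (mat_norm (H s \<omega>) (y s k \<omega> - v s k \<omega>))\<^sup>2) (\<gamma> s)) \<in> borel_measurable ?F" (is "?r \<in> _")
      unfolding model_grad_def mat_norm_def by measurable
    have "(\<lambda>\<omega>. y s k \<omega> + ?r \<omega> *\<^sub>R (v s k \<omega> - y s k \<omega>)) \<in> borel_measurable ?F"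
      by measurable
    then show ?case
      by (rule measurable_cong[THEN iffD1, rotated])
        (simp add: space_F inner_step[OF s k] step_size[OF s k])
  qed
  from this[OF order_refl] have "x (Suc s) \<in> borel_measurable ?F"
    by (rule measurable_cong[THEN iffD1, rotated]) (simp add: space_F outer_step[OF s])
  then show ?case by simp
qed

lemma borel_measurable_M:
  "s \<le> T \<Longrightarrow> x s \<in> borel_measurable M" "s \<le> T \<Longrightarrow> previous \<alpha> s \<in> borel_measurable M"
  "s < T \<Longrightarrow> \<alpha> s \<in> borel_measurable M" "s < T \<Longrightarrow> batch s \<in> M \<rightarrow>\<^sub>M count_space UNIV"
  using borel_measurable_run[of s] borel_measurable_run[of "Suc s"] batch_measurable[of s]
    measurable_from_subalg[OF F_subalgebra] by auto

section \<open>Boundedness and integrability\<close>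

lemma integrable_boundedI:
  fixes h :: "'w \<Rightarrow> real"
  shows "h \<in> borel_measurable M \<Longrightarrow> (\<And>\<omega>. \<omega> \<in> space M \<Longrightarrow> \<bar>h \<omega>\<bar> \<le> B) \<Longrightarrow> integrable M h"
  by (rule integrable_const_bound[where B = B]) auto

lemma deriv_vec_bounded: "\<exists>B\<ge>0. \<forall>z\<in>C. \<forall>i. \<bar>df z $ i\<bar> \<le> B"
proof (intro exI conjI ballI allI)
  \<comment> \<open>Each summand bounds one entry, by its value at \<open>x0\<close> plus the
    Lipschitz variation over \<open>C\<close>; the sum bounds all entries at once. The absolute
    value of \<open>L\<close> appears because \<open>L_pos\<close> presupposes some
    \<open>s < T\<close>.\<close>
  let ?B = "\<Sum>i\<in>UNIV. \<bar>df x0 $ i\<bar> + \<bar>L\<bar> * (norm (a i) * D2) / real CARD('m)"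
  have D2: "0 \<le> D2"
    using norm_diff_le_diameter[OF start_point start_point] by simp
  then show "0 \<le> ?B"
    by (intro sum_nonneg) simp
  fix z i assume z: "z \<in> C"
  have "\<bar>deriv (f i) (a i \<bullet> z) - deriv (f i) (a i \<bullet> x0)\<bar> \<le> L * \<bar>a i \<bullet> (z - x0)\<bar>"
    using lipschitz[of "a i \<bullet> z" i "a i \<bullet> x0"] z start_point by (auto simp: inner_diff_right)
  also have "\<dots> \<le> \<bar>L\<bar> * \<bar>a i \<bullet> (z - x0)\<bar>"
    by (intro mult_right_mono) auto
  also have "\<dots> \<le> \<bar>L\<bar> * (norm (a i) * norm (z - x0))"
    by (intro mult_left_mono Cauchy_Schwarz_ineq2) auto
  also have "\<dots> \<le> \<bar>L\<bar> * (norm (a i) * D2)"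
    using norm_diff_le_diameter[OF start_point z] by (intro mult_left_mono) auto
  finally have "\<bar>deriv (f i) (a i \<bullet> z)\<bar> \<le> \<bar>deriv (f i) (a i \<bullet> x0)\<bar> + \<bar>L\<bar> * (norm (a i) * D2)"
    by linarith
  from divide_right_mono[OF this, of "real CARD('m)"]
  have "\<bar>df z $ i\<bar> \<le> \<bar>df x0 $ i\<bar> + \<bar>L\<bar> * (norm (a i) * D2) / real CARD('m)"
    by (simp add: deriv_vec_def add_divide_distrib)
  also have "\<dots> \<le> ?B"
    using D2 by (intro member_le_sum) auto
  finally show "\<bar>df z $ i\<bar> \<le> ?B" .
qed

lemma estimator_bounded:
  assumes B: "0 \<le> B" "\<And>z i. z \<in> C \<Longrightarrow> \<bar>df z $ i\<bar> \<le> B" and \<omega>: "\<omega> \<in> space M"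
  shows "s \<le> T \<Longrightarrow> \<bar>previous \<alpha> s \<omega> $ i\<bar> \<le> B"
proof (induction s)
  case (Suc s)
  then show ?case
    using B(2) x_in_C[OF _ \<omega>] by (simp add: \<alpha>_eq[OF _ \<omega>])
qed (use B in simp)

lemma integrable_component_error:
  assumes "s \<le> T" "r \<le> T"
  shows "integrable M (\<lambda>\<omega>. \<bar>(df (x s \<omega>) - previous \<alpha> r \<omega>) $ i\<bar>)"
proof -
  obtain B where B: "0 \<le> B" "\<And>z i. z \<in> C \<Longrightarrow> \<bar>df z $ i\<bar> \<le> B"
    using deriv_vec_bounded by blast
  have [measurable]: "(\<lambda>\<omega>. df (x s \<omega>) $ i) \<in> borel_measurable M" "(\<lambda>\<omega>. previous \<alpha> r \<omega> $ i) \<in> borel_measurable M"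
    by (intro borel_measurable_vec_nth borel_measurable_deriv_vec borel_measurable_M assms)+
  show ?thesis
  proof (rule integrable_boundedI)
    show "(\<lambda>\<omega>. \<bar>(df (x s \<omega>) - previous \<alpha> r \<omega>) $ i\<bar>) \<in> borel_measurable M"
      by simp
    fix \<omega> assume \<omega>: "\<omega> \<in> space M"
    show "\<bar>\<bar>(df (x s \<omega>) - previous \<alpha> r \<omega>) $ i\<bar>\<bar> \<le> 2 * B"
      using B(2)[OF x_in_C[OF assms(1) \<omega>], of i] estimator_bounded[OF B \<omega> assms(2), of i] by simp
  qed
qed

lemma integrable_error:
  "s \<le> T \<Longrightarrow> r \<le> T \<Longrightarrow> integrable M (\<lambda>\<omega>. l1norm (df (x s \<omega>) - previous \<alpha> r \<omega>))"
  unfolding l1norm_def by (intro Bochner_Integration.integrable_sum integrable_component_error)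

lemma integrable_objective:
  assumes "s \<le> T"
  shows "integrable M (\<lambda>\<omega>. obj (x s \<omega>))"
proof -
  have cont: "continuous_on UNIV (f i)" for i
    using differentiable by (simp add: continuous_on_eq_continuous_at differentiable_imp_continuous_within)
  have cont_obj: "continuous_on UNIV obj"
    unfolding objective_def by (intro continuous_intros continuous_on_compose2[OF cont]) auto
  then have "compact (obj ` C)"
    by (intro compact_continuous_image compact_C) (auto elim: continuous_on_subset)
  then obtain B where "\<forall>z\<in>C. \<bar>obj z\<bar> \<le> B"
    by (auto dest!: compact_imp_bounded simp: bounded_iff)
  then show ?thesis
    using x_in_C[OF assms]
    by (intro integrable_boundedI measurable_compose[OF borel_measurable_M(1)[OF assms]]
        borel_measurable_continuous_onI cont_obj) auto
qed

section \<open>Decay of the expected estimation error\<close>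

lemma expected_error_batch:
  assumes s: "s < T"
  shows "expectation (\<lambda>\<omega>. l1norm (df (x s \<omega>) - \<alpha> s \<omega>))
    = (1 - real b / real CARD('m)) * expectation (\<lambda>\<omega>. l1norm (df (x s \<omega>) - previous \<alpha> s \<omega>))"
proof -
  define Z where "Z i \<omega> = \<bar>(df (x s \<omega>) - previous \<alpha> s \<omega>) $ i\<bar>" for i \<omega>
  define I where "I i = (indicator {xs. i \<notin> set xs} :: 'm list \<Rightarrow> real)" for i
  note batch_M = borel_measurable_M(4)[OF s]
  have Z_int: "integrable M (Z i)" for i
    unfolding Z_def using s by (intro integrable_component_error) auto
  have I_int: "integrable M (\<lambda>\<omega>. I i (batch s \<omega>))" for i
    by (intro integrable_boundedI[where B = 1] measurable_compose[OF batch_M])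
      (auto simp: I_def indicator_def)
  have Z_meas: "Z i \<in> borel_measurable (F s)" for i
    unfolding Z_def using borel_measurable_run[of s] s
    by (auto intro!: borel_measurable_abs borel_measurable_vec_nth borel_measurable_diff borel_measurable_deriv_vec)
  have I_exp: "expectation (\<lambda>\<omega>. I i (batch s \<omega>)) = 1 - real b / real CARD('m)" for i
  proof -
    have "expectation (\<lambda>\<omega>. I i (batch s \<omega>)) = (\<integral>xs. I i xs \<partial>distr M (count_space UNIV) (batch s))"
      by (rule integral_distr[symmetric, OF batch_M]) simp
    also have "\<dots> = measure (measure_pmf (pmf_of_set (batches b))) {xs. i \<notin> set xs}"
      unfolding batch_distr[OF s] I_def by simp
    finally show ?thesis
      by (simp add: prob_not_in_batch[OF batch_size(2)])
  qed
  have prod: "expectation (\<lambda>\<omega>. Z i \<omega> * I i (batch s \<omega>)) = expectation (Z i) * (1 - real b / real CARD('m))"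
    and prod_int: "integrable M (\<lambda>\<omega>. Z i \<omega> * I i (batch s \<omega>))" for i
  proof -
    show "expectation (\<lambda>\<omega>. Z i \<omega> * I i (batch s \<omega>)) = expectation (Z i) * (1 - real b / real CARD('m))"
      using expectation_mult_indep[OF F_subalgebra batch_indep[OF s] Z_meas Z_int batch_M I_int]
      by (simp add: I_exp)
    show "integrable M (\<lambda>\<omega>. Z i \<omega> * I i (batch s \<omega>))"
      by (rule Bochner_Integration.integrable_bound[OF Z_int[of i]])
        (use Z_int I_int in \<open>auto simp: I_def indicator_def\<close>)
  qed
  \<comment> \<open>A sampled entry is exact at \<open>x s\<close>, and any other keeps its old
    error. The first factor depends on the past, the second only on the fresh batch.\<close>
  have "\<bar>(df (x s \<omega>) - \<alpha> s \<omega>) $ i\<bar> = Z i \<omega> * I i (batch s \<omega>)" if "\<omega> \<in> space M" for i \<omega>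
    by (simp add: Z_def I_def \<alpha>_eq[OF s that])
  then have "expectation (\<lambda>\<omega>. l1norm (df (x s \<omega>) - \<alpha> s \<omega>))
      = expectation (\<lambda>\<omega>. \<Sum>i\<in>UNIV. Z i \<omega> * I i (batch s \<omega>))"
    unfolding l1norm_def by (intro Bochner_Integration.integral_cong refl sum.cong)
  also have "\<dots> = (\<Sum>i\<in>UNIV. expectation (Z i) * (1 - real b / real CARD('m)))"
    using prod_int prod by (simp add: Bochner_Integration.integral_sum)
  also have "\<dots> = (\<Sum>i\<in>UNIV. expectation (Z i)) * (1 - real b / real CARD('m))"
    by (rule sum_distrib_right[symmetric])
  also have "(\<Sum>i\<in>UNIV. expectation (Z i)) = expectation (\<lambda>\<omega>. l1norm (df (x s \<omega>) - previous \<alpha> s \<omega>))"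
    unfolding l1norm_def Z_def[symmetric]
    by (rule Bochner_Integration.integral_sum[symmetric]) (rule Z_int)
  finally show ?thesis
    by (simp only: mult.commute)
qed

text \<open>The factor \<open>1 - b / m\<close> multiplies the error of the old vector
  \<open>\<alpha> s\<close> at the new iterate, which exceeds the error at \<open>x s\<close> by at
  most the drift of \<open>df\<close>.\<close>

lemma expected_error_step:
  assumes s: "Suc s < T"
  shows "expectation (\<lambda>\<omega>. l1norm (df (x (Suc s) \<omega>) - \<alpha> (Suc s) \<omega>))
    \<le> (1 - real b / real CARD('m)) * (expectation (\<lambda>\<omega>. l1norm (df (x s \<omega>) - \<alpha> s \<omega>))
      + real K * L * D1 / real CARD('m) * \<gamma> s)"
proof -
  have int: "integrable M (\<lambda>\<omega>. l1norm (df (x r \<omega>) - \<alpha> s \<omega>))" if "r \<le> T" for r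
    using integrable_error[OF that, of "Suc s"] s by simp
  have "expectation (\<lambda>\<omega>. l1norm (df (x (Suc s) \<omega>) - \<alpha> s \<omega>))
      \<le> expectation (\<lambda>\<omega>. l1norm (df (x s \<omega>) - \<alpha> s \<omega>) + real K * L * D1 / real CARD('m) * \<gamma> s)"
  proof (rule integral_mono)
    fix \<omega> assume \<omega>: "\<omega> \<in> space M"
    have "df (x (Suc s) \<omega>) - \<alpha> s \<omega> = (df (x s \<omega>) - \<alpha> s \<omega>) + (df (x (Suc s) \<omega>) - df (x s \<omega>))"
      by simp
    then show "l1norm (df (x (Suc s) \<omega>) - \<alpha> s \<omega>)
        \<le> l1norm (df (x s \<omega>) - \<alpha> s \<omega>) + real K * L * D1 / real CARD('m) * \<gamma> s"
      using l1norm_triangle[of "df (x s \<omega>) - \<alpha> s \<omega>" "df (x (Suc s) \<omega>) - df (x s \<omega>)"]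
        deriv_vec_step[OF \<omega>, of s] s by simp
  qed (use int s in auto)
  also have "\<dots> = expectation (\<lambda>\<omega>. l1norm (df (x s \<omega>) - \<alpha> s \<omega>)) + real K * L * D1 / real CARD('m) * \<gamma> s"
    using int[of s] s by (simp add: prob_space)
  finally show ?thesis
    unfolding expected_error_batch[OF s] using batch_size by (simp add: mult_left_mono)
qed

section \<open>The expected gap\<close>

lemma AE_batches: "AE \<omega> in M. \<forall>s<T. batch s \<omega> \<in> batches b"
proof -
  have "AE \<omega> in M. batch s \<omega> \<in> batches b" if "s < T" for s
  proof -
    \<comment> \<open>Only the distribution of a batch is prescribed, so its length and distinctness
      hold almost surely.\<close>
    have "AE xs in distr M (count_space UNIV) (batch s). xs \<in> batches b"
      unfolding batch_distr[OF that]
      using batches_nonempty[OF batch_size(2)] by (simp add: AE_measure_pmf_iff finite_batches)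
    then show ?thesis
      by (simp add: AE_distr_iff[OF borel_measurable_M(4)[OF that]])
  qed
  then have "AE \<omega> in M. \<forall>s\<in>{..<T}. batch s \<omega> \<in> batches b"
    by (intro AE_finite_allI) auto
  then show ?thesis
    by eventually_elim auto
qed

lemma expected_gap_step:
  assumes s: "s < T" and z: "z \<in> C"
  shows "expectation (\<lambda>\<omega>. obj (x (Suc s) \<omega>)) - obj z
    \<le> (1 - \<gamma> s) * (expectation (\<lambda>\<omega>. obj (x s \<omega>)) - obj z)
      + \<gamma> s * ((real K + 1) * Dinf) * expectation (\<lambda>\<omega>. l1norm (df (x s \<omega>) - \<alpha> s \<omega>))
      + (\<gamma> s)\<^sup>2 * (L * (hi 0 / lo 0 * \<sigma>\<^sup>2 * D2\<^sup>2 / real CARD('m))) / 2"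
    (is "_ \<le> _ + ?c * _ + ?d")
proof -
  have int: "integrable M (\<lambda>\<omega>. obj (x s \<omega>))" "integrable M (\<lambda>\<omega>. obj (x (Suc s) \<omega>))"
    "integrable M (\<lambda>\<omega>. l1norm (df (x s \<omega>) - \<alpha> s \<omega>))"
    using integrable_objective[of s] integrable_objective[of "Suc s"] integrable_error[of s "Suc s"] s by auto
  have "expectation (\<lambda>\<omega>. obj (x (Suc s) \<omega>) - obj z)
      \<le> expectation (\<lambda>\<omega>. (1 - \<gamma> s) * (obj (x s \<omega>) - obj z) + ?c * l1norm (df (x s \<omega>) - \<alpha> s \<omega>) + ?d)"
  proof (rule integral_mono_AE)
    show "AE \<omega> in M. obj (x (Suc s) \<omega>) - obj z
        \<le> (1 - \<gamma> s) * (obj (x s \<omega>) - obj z) + ?c * l1norm (df (x s \<omega>) - \<alpha> s \<omega>) + ?d"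
      using AE_batches AE_space by eventually_elim (use gap_step[OF _ _ s z] in blast)
  qed (use int in auto)
  then show ?thesis
    using int by (simp add: prob_space)
qed

text \<open>An arbitrary \<open>z\<close> in \<open>C\<close> stands in for a minimiser; the passage
  to the infimum comes at the very end.\<close>

theorem expected_gap_bound:
  assumes step: "\<And>s. s < T \<Longrightarrow> \<gamma> s = 2 / (real s + 2)" and t: "1 \<le> t" "t \<le> T" and z: "z \<in> C"
  shows "expectation (\<lambda>\<omega>. obj (x t \<omega>)) - obj z
    \<le> 2 * L / (real t + 1) *
        (4 * real K * (real K + 1) * D1 * Dinf * (1 / real b - 1 / real CARD('m))
          + hi 0 / lo 0 * \<sigma>\<^sup>2 * D2\<^sup>2 / real CARD('m))
      + 2 * (real K + 1) * Dinf * (real CARD('m) / real b)\<^sup>2 / (real t * (real t + 1)) *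
        (expectation (\<lambda>\<omega>. l1norm (df x0 - \<alpha> 0 \<omega>)) + 16 * real K * L * D1 / real b)"
proof -
  define e where "e s = expectation (\<lambda>\<omega>. l1norm (df (x s \<omega>) - \<alpha> s \<omega>))" for s
  \<comment> \<open>\<open>u\<close> is the reciprocal of the probability that an index is sampled.
    Since \<open>u * (1 - b / m) = u - 1\<close>, the error recurrence takes the form required by
    \<open>error_sum_bound\<close>.\<close>
  define u where "u = real CARD('m) / real b"
  define c where "c = real K * L * D1 / real CARD('m)"
  define N where "N = L * (hi 0 / lo 0 * \<sigma>\<^sup>2 * D2\<^sup>2 / real CARD('m))"
  define B where "B = (real K + 1) * Dinf"
  define S where "S = (\<Sum>s<t. (real s + 1) * e s)"
  have T: "0 < T" using t by simp
  have b: "0 < real b" using batch_size by simp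
  have u: "1 \<le> u"
    using batch_size b by (simp add: u_def)
  have c: "0 \<le> c"
    using L_pos[OF T] D1_nonneg by (simp add: c_def)
  have N: "0 \<le> N"
    using L_pos[OF T] lo_pos[OF T] lo_le_hi[OF T] by (simp add: N_def)
  have B: "0 \<le> B"
    using Dinf_nonneg by (simp add: B_def)
  have e: "0 \<le> e s" for s
    unfolding e_def by (intro Bochner_Integration.integral_nonneg l1norm_nonneg)
  have S_le: "S \<le> 4 * real t * c * (u - 1) + u\<^sup>2 * (e 0 + 16 * c * u)"
    unfolding S_def
  proof (rule error_sum_bound[OF u c e t(1)])
    fix s assume "Suc s < t"
    then have s: "Suc s < T" "s < T" using t by auto
    have "u * e (Suc s) \<le> u * ((1 - real b / real CARD('m)) * (e s + c * \<gamma> s))"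
      using expected_error_step[OF s(1)] u by (intro mult_left_mono) (auto simp: e_def c_def)
    also have "\<dots> = (u - 1) * (e s + c * (2 / (real s + 2)))"
    proof -
      have "u * (1 - real b / real CARD('m)) = u - 1"
        using b by (simp add: u_def right_diff_distrib)
      then show ?thesis
        by (simp only: step[OF s(2)] mult.assoc[symmetric])
    qed
    finally show "u * e (Suc s) \<le> (u - 1) * (e s + c * (2 / (real s + 2)))" .
  qed
  have "real t * (real t + 1) * (expectation (\<lambda>\<omega>. obj (x t \<omega>)) - obj z) \<le> 2 * B * S + 2 * real t * N"
    unfolding S_def
  proof (rule gap_bound[OF N])
    fix s assume "s < t"
    then have "s < T" using t by simp
    from expected_gap_step[OF this z] step[OF this]
    show "expectation (\<lambda>\<omega>. obj (x (Suc s) \<omega>)) - obj z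
        \<le> (1 - 2 / (real s + 2)) * (expectation (\<lambda>\<omega>. obj (x s \<omega>)) - obj z)
          + 2 / (real s + 2) * B * e s + (2 / (real s + 2))\<^sup>2 * N / 2"
      by (simp add: B_def N_def e_def)
  qed
  also have "\<dots> \<le> 2 * B * (4 * real t * c * (u - 1) + u\<^sup>2 * (e 0 + 16 * c * u)) + 2 * real t * N"
    using S_le B by (intro add_right_mono mult_left_mono) auto
  finally have "expectation (\<lambda>\<omega>. obj (x t \<omega>)) - obj z
      \<le> (2 * B * (4 * real t * c * (u - 1) + u\<^sup>2 * (e 0 + 16 * c * u)) + 2 * real t * N)
        / (real t * (real t + 1))"
    using t by (simp add: pos_le_divide_eq mult.commute)
  \<comment> \<open>The part proportional to \<open>t\<close> decays like
    \<open>1 / (t + 1)\<close>, the rest like \<open>1 / (t * (t + 1))\<close>.\<close>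
  also have "\<dots> = 2 / (real t + 1) * (4 * B * (c * (u - 1)) + N)
      + 2 * B * u\<^sup>2 / (real t * (real t + 1)) * (e 0 + 16 * (c * u))"
    using t by (simp add: divide_simps) (simp add: algebra_simps)
  also have "c * (u - 1) = real K * L * D1 * (1 / real b - 1 / real CARD('m))"
    using b by (simp add: c_def u_def field_simps)
  also have "c * u = real K * L * D1 / real b"
    by (simp add: c_def u_def)
  also have "e 0 = expectation (\<lambda>\<omega>. l1norm (df x0 - \<alpha> 0 \<omega>))"
    unfolding e_def by (intro Bochner_Integration.integral_cong refl) (simp add: init)
  finally show ?thesis
    by (simp add: B_def N_def u_def algebra_simps)
qed

end

theorem theorem3p7:
  fixes M :: "'w measure" and F :: "nat \<Rightarrow> 'w measure"
    and C :: "(real^'n) set"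
    and a :: "'m::finite \<Rightarrow> real^'n"
    and f :: "'m \<Rightarrow> real \<Rightarrow> real"
    and L :: real
    and T b K t :: nat
    and lo hi \<eta> \<gamma> :: "nat \<Rightarrow> real"
    and x0 :: "real^'n"
    and batch :: "nat \<Rightarrow> 'w \<Rightarrow> 'm list"
    and \<alpha> :: "nat \<Rightarrow> 'w \<Rightarrow> real^'m"
    and g :: "nat \<Rightarrow> 'w \<Rightarrow> real^'n"
    and G H :: "nat \<Rightarrow> 'w \<Rightarrow> real^'n^'n"
    and v y :: "nat \<Rightarrow> nat \<Rightarrow> 'w \<Rightarrow> real^'n"
    and \<gamma>' :: "nat \<Rightarrow> nat \<Rightarrow> 'w \<Rightarrow> real"
    and x :: "nat \<Rightarrow> 'w \<Rightarrow> real^'n"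
  defines "A \<equiv> data_matrix a"
    and "m \<equiv> real CARD('m)"
    and "D1A \<equiv> image_diameter l1norm (data_matrix a) C"
    and "DinfA \<equiv> image_diameter infnorm (data_matrix a) C"
    and "D2 \<equiv> diameter C"
    and "\<kappa> \<equiv> hi 0 / lo 0"
  assumes "compact C" and "convex C"
    and "\<And>i r. f i differentiable (at r)"
    and "\<And>i. convex_on UNIV (f i)"
    and "\<And>i r s. r \<in> (\<lambda>z. a i \<bullet> z) ` C \<Longrightarrow> s \<in> (\<lambda>z. a i \<bullet> z) ` C \<Longrightarrow>
           \<bar>deriv (f i) r - deriv (f i) s\<bar> \<le> L * \<bar>r - s\<bar>"
    and "adacsfw M F C a f T b K lo hi \<eta> \<gamma> x0 batch \<alpha> g G H v y \<gamma>' x"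
    and "\<And>s. s < T \<Longrightarrow> \<eta> s = m * lo s / (L * (spectral_norm A)\<^sup>2)"
    and "\<And>s. s < T \<Longrightarrow> \<gamma> s = 2 / (real s + 2)"
    and "1 \<le> t" and "t \<le> T"
  shows "(\<integral>\<omega>. objective a f (x t \<omega>) \<partial>M) - (INF z\<in>C. objective a f z)
    \<le> 2 * L / (real t + 1) *
        (4 * real K * (real K + 1) * D1A * DinfA * (1 / real b - 1 / m)
          + \<kappa> * (spectral_norm A)\<^sup>2 * D2\<^sup>2 / m)
      + 2 * (real K + 1) * DinfA * (m / real b)\<^sup>2 / (real t * (real t + 1)) *
        ((\<integral>\<omega>. l1norm (deriv_vec a f x0 - \<alpha> 0 \<omega>) \<partial>M) + 16 * real K * L * D1A / real b)"
proof -
  interpret adacsfw_smooth M F C a f T b K lo hi \<eta> \<gamma> x0 batch \<alpha> g G H v y \<gamma>' x L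
    using assms unfolding adacsfw_smooth_def adacsfw_smooth_axioms_def by blast
  let ?R = "2 * L / (real t + 1) *
        (4 * real K * (real K + 1) * D1A * DinfA * (1 / real b - 1 / m)
          + \<kappa> * (spectral_norm A)\<^sup>2 * D2\<^sup>2 / m)
      + 2 * (real K + 1) * DinfA * (m / real b)\<^sup>2 / (real t * (real t + 1)) *
        ((\<integral>\<omega>. l1norm (deriv_vec a f x0 - \<alpha> 0 \<omega>) \<partial>M) + 16 * real K * L * D1A / real b)"
  \<comment> \<open>With the integral on the left, the bound becomes a lower bound for the objective
    on all of \<open>C\<close>, hence for its infimum.\<close>
  have "(\<integral>\<omega>. objective a f (x t \<omega>) \<partial>M) - ?R \<le> objective a f z" if "z \<in> C" for z
    using expected_gap_bound[of t z] assms that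
    by (simp add: A_def m_def D1A_def DinfA_def D2_def \<kappa>_def algebra_simps)
  then have "(\<integral>\<omega>. objective a f (x t \<omega>) \<partial>M) - ?R \<le> (INF z\<in>C. objective a f z)"
    using C_nonempty by (intro cINF_greatest)
  then show ?thesis
    by linarith
qed

end
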